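(* Every $3$-dimensional $\eta$-Einstein $(\varepsilon)$-almost paracontact metric manifold is pseudo-symmetric (in the sense of Deszcz). In particular, every $3$-dimensional $(\varepsilon)$-para Sasakian manifold is pseudo-symmetric (in the sense of Deszcz).
   Context: All manifolds and tensor fields are smooth; $\mathfrak X(M)$ denotes the vector fields on $M$. An almost paracontact structure $(\varphi,\xi,\eta)$ on $M$ consists of a $(1,1)$-tensor field $\varphi$, a vector field $\xi$ and a $1$-form $\eta$ with $\varphi^2=I-\eta\otimes\xi$, $\eta(\xi)=1$, $\varphi\xi=0$, $\eta\circ\varphi=0$. A semi-Riemannian metric is a non-degenerate symmetric $(0,2)$-tensor field (of some constant index, arbitrary). If $g$ is a semi-Riemannian metric on $M$ with $g(\varphi X,\varphi Y)=g(X,Y)-\varepsilon\eta(X)\eta(Y)$ for all $X,Y\in\mathfrak X(M)$, where $\varepsilon\in\{1,-1\}$ is a constant, then $(M,\varphi,\xi,\eta,g,\varepsilon)$ is an $(\varepsilon)$-almost paracontact metric manifold. It is an $(\varepsilon)$-para Sasakian manifold if moreover $(\nabla_X\varphi)Y=-g(\varphi X,\varphi Y)\xi-\varepsilon\eta(Y)\varphi^2X$ for all $X,Y\in\mathfrak X(M)$, where $\nabla$ is the Levi-Civita connection of $g$. Curvature conventions: $R(X,Y)Z=\nabla_X\nabla_YZ-\nabla_Y\nabla_XZ-\nabla_{[X,Y]}Z$, the Ricci tensor is $S(Y,Z)=\mathrm{trace}(X\mapsto R(X,Y)Z)$, the Ricci operator $Q$ is defined by $g(QX,Y)=S(X,Y)$,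 and the scalar curvature is $r=\mathrm{trace}\,Q$. An $(\varepsilon)$-almost paracontact metric manifold is $\eta$-Einstein if $S(X,Y)=a\,g(X,Y)+b\,\eta(X)\eta(Y)$ for all $X,Y\in\mathfrak X(M)$, for some smooth functions $a,b$ on $M$. Put $R_g(X,Y)Z=g(Y,Z)X-g(X,Z)Y$. For $F\in\{R,R_g\}$ and a tensor field $P$ of type $(1,s)$, define the $(1,s+2)$-tensor field $F\cdot P$ by $$(F\cdot P)(X_1,\ldots,X_s;Y,X)=F(X,Y)\{P(X_1,\ldots,X_s)\}-\sum_{j=1}^sP(X_1,\ldots,F(X,Y)X_j,\ldots,X_s).$$ Here $R$ itself is regarded as a $(1,3)$-tensor field. An $n$-dimensional semi-Riemannian manifold $(M,g)$ is pseudo-symmetric (in the sense of Deszcz) if there is a smooth function $L:M\to\mathbb R$ such that $R\cdot R=L\,R_g\cdot R$ holds on the set $U=\{x\in M: R\neq\frac{r}{n(n-1)}R_g\text{ at }x\}$. *)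

theory Defs
  imports "HOL-Analysis.Analysis" "HOL-Library.Function_Algebras"
begin

text \<open>
  Arithmetic on functions is pointwise (\<^theory>\<open>HOL-Library.Function_Algebras\<close>), so that real functions
  on the manifold, and operators on such functions, can be added and subtracted, and real functions can
  be multiplied.
\<close>

section \<open>Smooth manifolds\<close>

text \<open>Continuous differentiability of order \<open>k\<close> on an open set.\<close>

primrec Ck_on :: "nat \<Rightarrow> 'e::real_normed_vector set \<Rightarrow> ('e \<Rightarrow> 'f::real_normed_vector) \<Rightarrow> bool" where
  "Ck_on 0 S f \<longleftrightarrow> continuous_on S f"
| "Ck_on (Suc k) S f \<longleftrightarrow>
     f differentiable_on S \<and> (\<forall>v. Ck_on k S (\<lambda>x. frechet_derivative f (at x) v))"

definition Cinf_on :: "'e::real_normed_vector set \<Rightarrow> ('e \<Rightarrow> 'f::real_normed_vector) \<Rightarrow> bool" where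
  "Cinf_on S f \<longleftrightarrow> (\<forall>k. Ck_on k S f)"

text \<open>
  The underlying topological space is the whole type \<open>'a\<close>, Hausdorff and second countable by its sort.
  A chart \<open>(U, c)\<close> is a map \<open>c\<close> of which only the values on the open set \<open>U\<close> matter. The dimension
  is \<open>DIM('e)\<close>. The atlas need not be maximal.
\<close>

type_synonym ('a, 'e) atlas = "('a set \<times> ('a \<Rightarrow> 'e)) set"

definition smooth_manifold ::
  "('a::{t2_space, second_countable_topology}, 'e::euclidean_space) atlas \<Rightarrow> bool" where
  "smooth_manifold M \<longleftrightarrow>
     (\<Union>(U, c)\<in>M. U) = UNIV \<and>
     (\<forall>(U, c)\<in>M. open U \<and> open (c ` U) \<and> homeomorphism U (c ` U) c (inv_into U c)) \<and>
     (\<forall>(U, c)\<in>M. \<forall>(V, d)\<in>M. Cinf_on (c ` (U \<inter> V)) (d \<circ> inv_into U c))"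

definition smooth_functions ::
  "('a::{t2_space, second_countable_topology}, 'e::euclidean_space) atlas \<Rightarrow> ('a \<Rightarrow> real) set" where
  "smooth_functions M = {f. \<forall>(U, c)\<in>M. Cinf_on (c ` U) (f \<circ> inv_into U c)}"


section \<open>Vector fields and tensor fields\<close>

text \<open>
  Vector fields are the derivations of the algebra of smooth functions. They are extended by \<open>0\<close> to
  functions that are not smooth, so that equality of vector fields is equality in HOL.
\<close>

type_synonym 'a vfield = "('a \<Rightarrow> real) \<Rightarrow> ('a \<Rightarrow> real)"

definition vector_fields ::
  "('a::{t2_space, second_countable_topology}, 'e::euclidean_space) atlas \<Rightarrow> 'a vfield set" where
  "vector_fields M =
     {X. (\<forall>f\<in>smooth_functions M. X f \<in> smooth_functions M) \<and>
         (\<forall>f\<in>smooth_functions M. \<forall>h\<in>smooth_functions M. X (f + h) = X f + X h) \<and>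
         (\<forall>f\<in>smooth_functions M. \<forall>k::real. X (\<lambda>p. k * f p) = (\<lambda>p. k * X f p)) \<and>
         (\<forall>f\<in>smooth_functions M. \<forall>h\<in>smooth_functions M. X (f * h) = X f * h + f * X h) \<and>
         (\<forall>f. f \<notin> smooth_functions M \<longrightarrow> X f = 0)}"

definition fscale :: "('a \<Rightarrow> real) \<Rightarrow> 'a vfield \<Rightarrow> 'a vfield" (infixr "\<odot>" 75) where
  "f \<odot> X = (\<lambda>h. f * X h)"

definition lie_bracket :: "'a vfield \<Rightarrow> 'a vfield \<Rightarrow> 'a vfield" where
  "lie_bracket X Y = (\<lambda>f. X (Y f) - Y (X f))"

text \<open>
  Tensor fields are multilinear over the ring of smooth functions; their values outside
  \<^const>\<open>vector_fields\<close> are irrelevant.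
\<close>

definition one_form ::
  "('a::{t2_space, second_countable_topology}, 'e::euclidean_space) atlas
     \<Rightarrow> ('a vfield \<Rightarrow> 'a \<Rightarrow> real) \<Rightarrow> bool" where
  "one_form M \<omega> \<longleftrightarrow>
     (\<forall>X\<in>vector_fields M. \<omega> X \<in> smooth_functions M) \<and>
     (\<forall>X\<in>vector_fields M. \<forall>Y\<in>vector_fields M. \<omega> (X + Y) = \<omega> X + \<omega> Y) \<and>
     (\<forall>f\<in>smooth_functions M. \<forall>X\<in>vector_fields M. \<omega> (f \<odot> X) = f * \<omega> X)"

definition tensor11 ::
  "('a::{t2_space, second_countable_topology}, 'e::euclidean_space) atlas
     \<Rightarrow> ('a vfield \<Rightarrow> 'a vfield) \<Rightarrow> bool" where
  "tensor11 M T \<longleftrightarrow>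
     (\<forall>X\<in>vector_fields M. T X \<in> vector_fields M) \<and>
     (\<forall>X\<in>vector_fields M. \<forall>Y\<in>vector_fields M. T (X + Y) = T X + T Y) \<and>
     (\<forall>f\<in>smooth_functions M. \<forall>X\<in>vector_fields M. T (f \<odot> X) = f \<odot> T X)"

definition tensor02 ::
  "('a::{t2_space, second_countable_topology}, 'e::euclidean_space) atlas
     \<Rightarrow> ('a vfield \<Rightarrow> 'a vfield \<Rightarrow> 'a \<Rightarrow> real) \<Rightarrow> bool" where
  "tensor02 M g \<longleftrightarrow>
     (\<forall>X\<in>vector_fields M. one_form M (\<lambda>Y. g X Y)) \<and>
     (\<forall>Y\<in>vector_fields M. one_form M (\<lambda>X. g X Y))"

text \<open>
  The tangent vector at \<open>p\<close> of a vector field \<open>X\<close> is the functional \<open>\<lambda>f. X f p\<close>, and every tangent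
  vector arises in this way. A basis at \<open>p\<close> consists of \<open>DIM('e)\<close> vector fields whose tangent vectors
  at \<open>p\<close> form a basis of the tangent space.
\<close>

definition basis_at ::
  "('a::{t2_space, second_countable_topology}, 'e::euclidean_space) atlas
     \<Rightarrow> 'a \<Rightarrow> (nat \<Rightarrow> 'a vfield) \<Rightarrow> bool" where
  "basis_at M p E \<longleftrightarrow>
     (\<forall>i<DIM('e). E i \<in> vector_fields M) \<and>
     (\<forall>k. (\<forall>f. (\<Sum>i<DIM('e). k i * E i f p) = 0) \<longrightarrow> (\<forall>i<DIM('e). k i = 0)) \<and>
     (\<forall>X\<in>vector_fields M. \<exists>k. \<forall>f. X f p = (\<Sum>i<DIM('e). k i * E i f p))"

definition trace_at ::
  "('a::{t2_space, second_countable_topology}, 'e::euclidean_space) atlas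
     \<Rightarrow> ('a vfield \<Rightarrow> 'a vfield) \<Rightarrow> 'a \<Rightarrow> real" where
  "trace_at M T p =
     (THE t. \<exists>E A. basis_at M p E \<and>
        (\<forall>i<DIM('e). \<forall>f. T (E i) f p = (\<Sum>j<DIM('e). A i j * E j f p)) \<and>
        t = (\<Sum>i<DIM('e). A i i))"


section \<open>Semi-Riemannian geometry\<close>

text \<open>
  The index at \<open>p\<close> is the largest dimension \<open>k\<close> of a subspace of the tangent space on which \<open>g\<close> is
  negative definite; the condition below makes \<open>E 0, \<dots>, E (k - 1)\<close> linearly independent at \<open>p\<close>.
\<close>

definition index_at ::
  "('a::{t2_space, second_countable_topology}, 'e::euclidean_space) atlas
     \<Rightarrow> ('a vfield \<Rightarrow> 'a vfield \<Rightarrow> 'a \<Rightarrow> real) \<Rightarrow> 'a \<Rightarrow> nat" where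
  "index_at M g p =
     Max {k. \<exists>E. (\<forall>i<k. E i \<in> vector_fields M) \<and>
           (\<forall>a::nat \<Rightarrow> real. (\<exists>i<k. a i \<noteq> 0) \<longrightarrow>
              (\<Sum>i<k. \<Sum>j<k. a i * a j * g (E i) (E j) p) < 0)}"

definition semi_riemannian_metric ::
  "('a::{t2_space, second_countable_topology}, 'e::euclidean_space) atlas
     \<Rightarrow> ('a vfield \<Rightarrow> 'a vfield \<Rightarrow> 'a \<Rightarrow> real) \<Rightarrow> bool" where
  "semi_riemannian_metric M g \<longleftrightarrow>
     tensor02 M g \<and>
     (\<forall>X\<in>vector_fields M. \<forall>Y\<in>vector_fields M. g X Y = g Y X) \<and>
     (\<forall>p. \<forall>X\<in>vector_fields M.
        (\<forall>Y\<in>vector_fields M. g X Y p = 0) \<longrightarrow> (\<forall>f. X f p = 0)) \<and>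
     (\<exists>\<nu>. \<forall>p. index_at M g p = \<nu>)"

definition affine_connection ::
  "('a::{t2_space, second_countable_topology}, 'e::euclidean_space) atlas
     \<Rightarrow> ('a vfield \<Rightarrow> 'a vfield \<Rightarrow> 'a vfield) \<Rightarrow> bool" where
  "affine_connection M nabla \<longleftrightarrow>
     (\<forall>Y\<in>vector_fields M. tensor11 M (\<lambda>X. nabla X Y)) \<and>
     (\<forall>X\<in>vector_fields M. \<forall>Y\<in>vector_fields M. \<forall>Z\<in>vector_fields M.
        nabla X (Y + Z) = nabla X Y + nabla X Z) \<and>
     (\<forall>X\<in>vector_fields M. \<forall>f\<in>smooth_functions M. \<forall>Y\<in>vector_fields M.
        nabla X (f \<odot> Y) = X f \<odot> Y + f \<odot> nabla X Y)"

definition levi_civita ::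
  "('a::{t2_space, second_countable_topology}, 'e::euclidean_space) atlas
     \<Rightarrow> ('a vfield \<Rightarrow> 'a vfield \<Rightarrow> 'a \<Rightarrow> real)
     \<Rightarrow> ('a vfield \<Rightarrow> 'a vfield \<Rightarrow> 'a vfield) \<Rightarrow> bool" where
  "levi_civita M g nabla \<longleftrightarrow>
     affine_connection M nabla \<and>
     (\<forall>X\<in>vector_fields M. \<forall>Y\<in>vector_fields M. nabla X Y - nabla Y X = lie_bracket X Y) \<and>
     (\<forall>X\<in>vector_fields M. \<forall>Y\<in>vector_fields M. \<forall>Z\<in>vector_fields M.
        X (g Y Z) = g (nabla X Y) Z + g Y (nabla X Z))"

definition curvature ::
  "('a vfield \<Rightarrow> 'a vfield \<Rightarrow> 'a vfield) \<Rightarrow> 'a vfield \<Rightarrow> 'a vfield \<Rightarrow> 'a vfield \<Rightarrow> 'a vfield" where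
  "curvature nabla X Y Z =
     nabla X (nabla Y Z) - nabla Y (nabla X Z) - nabla (lie_bracket X Y) Z"

definition ricci ::
  "('a::{t2_space, second_countable_topology}, 'e::euclidean_space) atlas
     \<Rightarrow> ('a vfield \<Rightarrow> 'a vfield \<Rightarrow> 'a vfield) \<Rightarrow> 'a vfield \<Rightarrow> 'a vfield \<Rightarrow> 'a \<Rightarrow> real" where
  "ricci M nabla Y Z = trace_at M (\<lambda>X. curvature nabla X Y Z)"

definition ricci_operator ::
  "('a::{t2_space, second_countable_topology}, 'e::euclidean_space) atlas
     \<Rightarrow> ('a vfield \<Rightarrow> 'a vfield \<Rightarrow> 'a \<Rightarrow> real)
     \<Rightarrow> ('a vfield \<Rightarrow> 'a vfield \<Rightarrow> 'a vfield) \<Rightarrow> 'a vfield \<Rightarrow> 'a vfield" where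
  "ricci_operator M g nabla X =
     (THE V. V \<in> vector_fields M \<and> (\<forall>Y\<in>vector_fields M. g V Y = ricci M nabla X Y))"

definition scalar_curvature ::
  "('a::{t2_space, second_countable_topology}, 'e::euclidean_space) atlas
     \<Rightarrow> ('a vfield \<Rightarrow> 'a vfield \<Rightarrow> 'a \<Rightarrow> real)
     \<Rightarrow> ('a vfield \<Rightarrow> 'a vfield \<Rightarrow> 'a vfield) \<Rightarrow> 'a \<Rightarrow> real" where
  "scalar_curvature M g nabla = trace_at M (ricci_operator M g nabla)"

definition metric_curvature ::
  "('a vfield \<Rightarrow> 'a vfield \<Rightarrow> 'a \<Rightarrow> real)
     \<Rightarrow> 'a vfield \<Rightarrow> 'a vfield \<Rightarrow> 'a vfield \<Rightarrow> 'a vfield" where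
  "metric_curvature g X Y Z = g Y Z \<odot> X - g X Z \<odot> Y"

text \<open>The tensor field \<open>F \<cdot> P\<close> for a \<open>(1, 3)\<close>-tensor field \<open>P\<close>.\<close>

definition curvature_action ::
  "('a vfield \<Rightarrow> 'a vfield \<Rightarrow> 'a vfield \<Rightarrow> 'a vfield)
     \<Rightarrow> ('a vfield \<Rightarrow> 'a vfield \<Rightarrow> 'a vfield \<Rightarrow> 'a vfield)
     \<Rightarrow> 'a vfield \<Rightarrow> 'a vfield \<Rightarrow> 'a vfield \<Rightarrow> 'a vfield \<Rightarrow> 'a vfield \<Rightarrow> 'a vfield" where
  "curvature_action F P X1 X2 X3 Y X =
     F X Y (P X1 X2 X3) - P (F X Y X1) X2 X3 - P X1 (F X Y X2) X3 - P X1 X2 (F X Y X3)"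

definition pseudo_symmetric ::
  "('a::{t2_space, second_countable_topology}, 'e::euclidean_space) atlas
     \<Rightarrow> ('a vfield \<Rightarrow> 'a vfield \<Rightarrow> 'a \<Rightarrow> real)
     \<Rightarrow> ('a vfield \<Rightarrow> 'a vfield \<Rightarrow> 'a vfield) \<Rightarrow> bool" where
  "pseudo_symmetric M g nabla \<longleftrightarrow>
     (let n = real DIM('e);
          R = curvature nabla;
          Rg = metric_curvature g;
          U = {p. \<exists>X\<in>vector_fields M. \<exists>Y\<in>vector_fields M. \<exists>Z\<in>vector_fields M. \<exists>f.
                 R X Y Z f p \<noteq> scalar_curvature M g nabla p / (n * (n - 1)) * Rg X Y Z f p}
      in \<exists>L\<in>smooth_functions M. \<forall>p\<in>U.
           \<forall>X1\<in>vector_fields M. \<forall>X2\<in>vector_fields M. \<forall>X3\<in>vector_fields M.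
           \<forall>Y\<in>vector_fields M. \<forall>X\<in>vector_fields M. \<forall>f.
             curvature_action R R X1 X2 X3 Y X f p =
             L p * curvature_action Rg R X1 X2 X3 Y X f p)"


section \<open>Almost paracontact metric manifolds\<close>

definition almost_paracontact ::
  "('a::{t2_space, second_countable_topology}, 'e::euclidean_space) atlas
     \<Rightarrow> ('a vfield \<Rightarrow> 'a vfield) \<Rightarrow> 'a vfield \<Rightarrow> ('a vfield \<Rightarrow> 'a \<Rightarrow> real) \<Rightarrow> bool" where
  "almost_paracontact M \<phi> \<xi> \<eta> \<longleftrightarrow>
     tensor11 M \<phi> \<and> \<xi> \<in> vector_fields M \<and> one_form M \<eta> \<and>
     (\<forall>X\<in>vector_fields M. \<phi> (\<phi> X) = X - \<eta> X \<odot> \<xi>) \<and>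
     \<eta> \<xi> = 1 \<and>
     \<phi> \<xi> = 0 \<and>
     (\<forall>X\<in>vector_fields M. \<eta> (\<phi> X) = 0)"

definition eps_almost_paracontact_metric ::
  "('a::{t2_space, second_countable_topology}, 'e::euclidean_space) atlas
     \<Rightarrow> ('a vfield \<Rightarrow> 'a vfield) \<Rightarrow> 'a vfield \<Rightarrow> ('a vfield \<Rightarrow> 'a \<Rightarrow> real)
     \<Rightarrow> ('a vfield \<Rightarrow> 'a vfield \<Rightarrow> 'a \<Rightarrow> real) \<Rightarrow> real \<Rightarrow> bool" where
  "eps_almost_paracontact_metric M \<phi> \<xi> \<eta> g \<epsilon> \<longleftrightarrow>
     almost_paracontact M \<phi> \<xi> \<eta> \<and> semi_riemannian_metric M g \<and> \<epsilon> \<in> {1, -1} \<and>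
     (\<forall>X\<in>vector_fields M. \<forall>Y\<in>vector_fields M. \<forall>p.
        g (\<phi> X) (\<phi> Y) p = g X Y p - \<epsilon> * \<eta> X p * \<eta> Y p)"

definition eta_einstein ::
  "('a::{t2_space, second_countable_topology}, 'e::euclidean_space) atlas
     \<Rightarrow> ('a vfield \<Rightarrow> 'a \<Rightarrow> real) \<Rightarrow> ('a vfield \<Rightarrow> 'a vfield \<Rightarrow> 'a \<Rightarrow> real)
     \<Rightarrow> ('a vfield \<Rightarrow> 'a vfield \<Rightarrow> 'a vfield) \<Rightarrow> bool" where
  "eta_einstein M \<eta> g nabla \<longleftrightarrow>
     (\<exists>a\<in>smooth_functions M. \<exists>b\<in>smooth_functions M.
        \<forall>X\<in>vector_fields M. \<forall>Y\<in>vector_fields M.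
          ricci M nabla X Y = a * g X Y + b * \<eta> X * \<eta> Y)"

text \<open>The left-hand side is \<open>(\<nabla>\<^sub>X \<phi>) Y\<close>.\<close>

definition eps_para_sasakian ::
  "('a::{t2_space, second_countable_topology}, 'e::euclidean_space) atlas
     \<Rightarrow> ('a vfield \<Rightarrow> 'a vfield) \<Rightarrow> 'a vfield \<Rightarrow> ('a vfield \<Rightarrow> 'a \<Rightarrow> real)
     \<Rightarrow> ('a vfield \<Rightarrow> 'a vfield \<Rightarrow> 'a \<Rightarrow> real) \<Rightarrow> real
     \<Rightarrow> ('a vfield \<Rightarrow> 'a vfield \<Rightarrow> 'a vfield) \<Rightarrow> bool" where
  "eps_para_sasakian M \<phi> \<xi> \<eta> g \<epsilon> nabla \<longleftrightarrow>
     eps_almost_paracontact_metric M \<phi> \<xi> \<eta> g \<epsilon> \<and>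
     (\<forall>X\<in>vector_fields M. \<forall>Y\<in>vector_fields M.
        nabla X (\<phi> Y) - \<phi> (nabla X Y) =
        - (g (\<phi> X) (\<phi> Y) \<odot> \<xi>) - (\<lambda>p. \<epsilon> * \<eta> Y p) \<odot> \<phi> (\<phi> X))"

end

theory Submission
  imports Defs
begin

text \<open>
The curvature of a three-dimensional semi-Riemannian manifold is determined by its Ricci tensor, and
here the Ricci tensor has an axis \<open>\<xi>\<close>. Take an orthogonal basis \<open>\<xi>, e\<^sub>1, e\<^sub>2\<close> of a tangent space. If
the two planes through \<open>\<xi>\<close> have the same sectional curvature \<open>\<kappa>\<close> and the mixed components of the
curvature vanish, then \<open>R(X, Y) - \<kappa> R\<^sub>g(X, Y)\<close> is skew for \<open>g\<close> and annihilates \<open>\<xi>\<close>: it is an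
infinitesimal rotation about the axis. The tensor \<open>R\<close> is built from \<open>g\<close> and \<open>\<xi>\<close> alone, so this rotation
acts trivially on it, and that says \<open>R \<cdot> R = \<kappa> R\<^sub>g \<cdot> R\<close> (\<open>model_curvature_derivation\<close> and
\<open>model_curvature_pseudo_symmetric\<close>).

The Ricci tensor \<open>a g + b \<eta> \<otimes> \<eta>\<close> of an \<open>\<eta>\<close>-Einstein manifold forces this shape with
\<open>\<kappa> = (a + \<epsilon> b) / 2\<close> (\<open>curvature_eq_model_if_ricci\<close>), and this \<open>\<kappa>\<close> is smooth. On an
\<open>\<epsilon>\<close>-para Sasakian manifold \<open>\<nabla>\<^sub>X \<xi> = \<epsilon> \<phi> X\<close>, hence \<open>R(X, Y) \<xi> = \<eta>(X) Y - \<eta>(Y) X\<close>, which forces the same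
shape with the constant \<open>\<kappa> = - \<epsilon>\<close> (\<open>curvature_eq_model_if_nullity\<close>). The curvature \<open>\<mu>\<close> of the plane
orthogonal to \<open>\<xi>\<close> enters only through the normal form at a single point, so \<open>\<kappa>\<close> is the only function
whose smoothness matters. In both cases the identity holds at every point of the manifold.

The remaining work makes this pointwise argument available. Vector fields are derivations and tensors are
maps linear over the smooth functions, so it has to be shown that tensors have values at points, and that
the tangent spaces have the dimension of the model space. The lemma \<open>tangent_frame_exists\<close> gives both: a
bump function turns the coordinates of a chart into global functions \<open>u b\<close> and the coordinate fields into
global vector fields \<open>E b\<close>, and Hadamard's lemma shows that a suitable multiple of every vector field is a
combination of the fields \<open>E b\<close> with smooth coefficients.
\<close>

section \<open>Continuously differentiable functions\<close>

lemma Ck_on_SucD: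
  assumes "Ck_on (Suc k) S f"
  shows "Ck_on k S f"
  using assms
proof (induction k arbitrary: f)
  case 0
  then show ?case by (simp add: differentiable_imp_continuous_on)
next
  case (Suc k)
  have d: "f differentiable_on S"
    and v: "\<And>v. Ck_on (Suc k) S (\<lambda>x. frechet_derivative f (at x) v)"
    using Suc.prems unfolding Ck_on.simps(2)[of "Suc k"] by blast+
  show ?case unfolding Ck_on.simps(2)[of k] using d Suc.IH[OF v] by blast
qed

lemma Ck_on_local:
  assumes "\<And>x. x \<in> S \<Longrightarrow> \<exists>N. open N \<and> x \<in> N \<and> Ck_on k N f"
  shows "Ck_on k S f"
  using assms
proof (induction k arbitrary: f)
  case 0
  show ?case
    unfolding Ck_on.simps
  proof (rule continuous_at_imp_continuous_on, rule ballI)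
    fix x assume "x \<in> S"
    then obtain N where "open N" "x \<in> N" "continuous_on N f" using 0[of x] by auto
    then show "isCont f x" by (simp add: continuous_on_eq_continuous_at)
  qed
next
  case (Suc k)
  have "f differentiable at x" if "x \<in> S" for x
  proof -
    obtain N where "open N" "x \<in> N" "Ck_on (Suc k) N f" using Suc.prems[OF \<open>x \<in> S\<close>] by blast
    then show ?thesis by (simp add: differentiable_on_eq_differentiable_at)
  qed
  then have "f differentiable_on S"
    by (simp add: differentiable_at_imp_differentiable_on)
  moreover have "Ck_on k S (\<lambda>x. frechet_derivative f (at x) v)" for v
  proof (rule Suc.IH)
    fix x assume "x \<in> S"
    then obtain N where "open N" "x \<in> N" "Ck_on (Suc k) N f" using Suc.prems by blast
    then show "\<exists>N. open N \<and> x \<in> N \<and> Ck_on k N (\<lambda>x. frechet_derivative f (at x) v)"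
      by (intro exI[of _ N]) simp
  qed
  ultimately show ?case by simp
qed

lemma Ck_on_subset:
  assumes "Ck_on k T f" "open T" "S \<subseteq> T"
  shows "Ck_on k S f"
  by (rule Ck_on_local) (use assms in blast)

text \<open>
The derivative is only known on \<open>S\<close>, whereas the Frechet derivative in the definition is a function on the
whole space; hence the appeal to congruence on \<open>S\<close> at order \<open>k\<close>. Congruence is itself proved by
induction from this lemma, so here it is a premise.
\<close>

lemma Ck_on_SucI_if_cong:
  assumes "open S" and "\<And>x. x \<in> S \<Longrightarrow> (f has_derivative f' x) (at x)"
    and "\<And>v. Ck_on k S (\<lambda>x. f' x v)"
    and cong: "\<And>v g. (\<And>x. x \<in> S \<Longrightarrow> f' x v = g x) \<Longrightarrow> Ck_on k S (\<lambda>x. f' x v) \<Longrightarrow> Ck_on k S g"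
  shows "Ck_on (Suc k) S f"
proof -
  have "f' x v = frechet_derivative f (at x) v" if "x \<in> S" for x v
    using assms(2)[OF that] frechet_derivative_at by metis
  then have "Ck_on k S (\<lambda>x. frechet_derivative f (at x) v)" for v
    using cong[where v=v and g="\<lambda>x. frechet_derivative f (at x) v"] assms(3)[of v] by simp
  moreover have "f differentiable_on S"
    using assms(2) by (meson differentiable_at_imp_differentiable_on differentiableI)
  ultimately show ?thesis by simp
qed

lemma Ck_on_cong:
  assumes "Ck_on k S f" and "open S" and "\<And>x. x \<in> S \<Longrightarrow> f x = g x"
  shows "Ck_on k S g"
  using assms(1,3)
proof (induction k arbitrary: f g)
  case 0
  then show ?case by (auto cong: continuous_on_cong)
next
  case (Suc k)
  have D: "(g has_derivative frechet_derivative f (at x)) (at x)" if "x \<in> S" for x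
  proof (rule has_derivative_transform_within_open[OF _ \<open>open S\<close> that Suc.prems(2)])
    show "(f has_derivative frechet_derivative f (at x)) (at x)"
      using Suc.prems(1) that \<open>open S\<close>
      by (simp add: differentiable_on_eq_differentiable_at frechet_derivative_works)
  qed
  show ?case
  proof (rule Ck_on_SucI_if_cong[OF \<open>open S\<close> D])
    show "Ck_on k S (\<lambda>x. frechet_derivative f (at x) v)" for v
      using Suc.prems(1) by simp
  qed (use Suc.IH in blast)+
qed

lemma Ck_on_SucI:
  assumes "open S" and "\<And>x. x \<in> S \<Longrightarrow> (f has_derivative f' x) (at x)"
    and "\<And>v. Ck_on k S (\<lambda>x. f' x v)"
  shows "Ck_on (Suc k) S f"
  by (rule Ck_on_SucI_if_cong[OF assms]) (use assms(1) in \<open>auto intro: Ck_on_cong\<close>)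

lemma Ck_on_Suc_has_derivative:
  assumes "Ck_on (Suc k) S f" "open S" "x \<in> S"
  shows "(f has_derivative frechet_derivative f (at x)) (at x)"
  using assms by (simp add: differentiable_on_eq_differentiable_at frechet_derivative_works)

lemma Ck_on_const: "open S \<Longrightarrow> Ck_on k S (\<lambda>x. c)"
proof (induction k arbitrary: c)
  case (Suc k)
  show ?case by (rule Ck_on_SucI[where f'="\<lambda>x v. 0"]) (use Suc in auto)
qed auto

lemma Ck_on_bounded_linear_comp:
  assumes "bounded_linear h" "open S" "Ck_on k S f"
  shows "Ck_on k S (\<lambda>x. h (f x))"
  using assms(3)
proof (induction k arbitrary: f)
  case 0
  then show ?case
    using assms(1) by (auto intro: bounded_linear.continuous_on)
next
  case (Suc k)
  have D: "((\<lambda>x. h (f x)) has_derivative (\<lambda>v. h (frechet_derivative f (at x) v))) (at x)"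
    if "x \<in> S" for x
    using bounded_linear.has_derivative[OF assms(1) Ck_on_Suc_has_derivative[OF Suc.prems assms(2) that]] .
  show ?case
    by (rule Ck_on_SucI[OF assms(2) D]) (use Suc assms in auto)
qed

lemma Ck_on_bounded_linear:
  assumes "bounded_linear h" "open S"
  shows "Ck_on k S h"
proof (cases k)
  case 0
  then show ?thesis using assms linear_continuous_on by auto
next
  case (Suc m)
  show ?thesis unfolding Suc
    by (rule Ck_on_SucI[where f'="\<lambda>x. h"])
      (use assms in \<open>auto intro: bounded_linear_imp_has_derivative Ck_on_const\<close>)
qed

lemma Ck_on_add:
  assumes "open S" "Ck_on k S f" "Ck_on k S g"
  shows "Ck_on k S (\<lambda>x. f x + g x)"
  using assms(2,3)
proof (induction k arbitrary: f g)
  case 0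
  then show ?case by (auto intro: continuous_intros)
next
  case (Suc k)
  show ?case
    by (rule Ck_on_SucI[OF assms(1) has_derivative_add
        [OF Ck_on_Suc_has_derivative Ck_on_Suc_has_derivative]])
      (use Suc assms in auto)
qed

lemma Ck_on_mult:
  fixes f g :: "'e::real_normed_vector \<Rightarrow> real"
  assumes "open S" "Ck_on k S f" "Ck_on k S g"
  shows "Ck_on k S (\<lambda>x. f x * g x)"
  using assms(2,3)
proof (induction k arbitrary: f g)
  case 0
  then show ?case by (auto intro: continuous_intros)
next
  case (Suc k)
  have D: "((\<lambda>x. f x * g x) has_derivative (\<lambda>v. f x * frechet_derivative g (at x) v
      + frechet_derivative f (at x) v * g x)) (at x)" if "x \<in> S" for x
    by (rule has_derivative_mult) (use that Suc.prems assms(1) Ck_on_Suc_has_derivative in auto)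
  show ?case
  proof (rule Ck_on_SucI[OF assms(1) D])
    fix v
    have "Ck_on k S f" "Ck_on k S g" using Suc.prems Ck_on_SucD by auto
    then show "Ck_on k S (\<lambda>x. f x * frechet_derivative g (at x) v + frechet_derivative f (at x) v * g x)"
      using Suc.prems assms(1) by (intro Ck_on_add Suc.IH) auto
  qed
qed

lemma Ck_on_sum:
  assumes "open S" "\<And>i. i \<in> I \<Longrightarrow> Ck_on k S (f i)"
  shows "Ck_on k S (\<lambda>x. \<Sum>i\<in>I. f i x)"
proof (cases "finite I")
  case True
  then show ?thesis using assms(2)
    by (induction I rule: finite_induct) (auto intro: Ck_on_const Ck_on_add assms(1))
qed (simp add: Ck_on_const assms(1))

lemma linear_Basis_expansion:
  fixes L :: "'e::euclidean_space \<Rightarrow> 'f::real_vector"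
  assumes "linear L"
  shows "L v = (\<Sum>b\<in>Basis. (v \<bullet> b) *\<^sub>R L b)"
proof -
  have "L v = L (\<Sum>b\<in>Basis. (v \<bullet> b) *\<^sub>R b)" by (simp add: euclidean_representation)
  also have "\<dots> = (\<Sum>b\<in>Basis. (v \<bullet> b) *\<^sub>R L b)"
    by (simp add: linear_sum[OF assms] linear_scale[OF assms])
  finally show ?thesis .
qed

lemma Ck_on_compose:
  fixes g :: "'d::real_normed_vector \<Rightarrow> 'e::euclidean_space" and f :: "'e \<Rightarrow> real"
  assumes "open S" "open T" "g ` S \<subseteq> T" "Ck_on k T f" "Ck_on k S g"
  shows "Ck_on k S (\<lambda>x. f (g x))"
  using assms(4,5)
proof (induction k arbitrary: f)
  case 0
  then show ?case using assms(3) continuous_on_compose2 by fastforce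
next
  case (Suc k)
  define D where "D x v = frechet_derivative f (at (g x)) (frechet_derivative g (at x) v)" for x v
  have D: "((\<lambda>x. f (g x)) has_derivative D x) (at x)" if "x \<in> S" for x
    unfolding D_def[abs_def]
    by (rule has_derivative_compose[OF Ck_on_Suc_has_derivative[OF Suc.prems(2)]
          Ck_on_Suc_has_derivative[OF Suc.prems(1)]]) (use that assms in auto)
  show ?case
  proof (rule Ck_on_SucI[OF assms(1) D])
    fix v
    have e: "D x v = (\<Sum>b\<in>Basis. (frechet_derivative g (at x) v \<bullet> b) *
        frechet_derivative f (at (g x)) b)" if "x \<in> S" for x
    proof -
      have "g x \<in> T" using that assms(3) by auto
      then have "linear (frechet_derivative f (at (g x)))"
        by (rule has_derivative_linear[OF Ck_on_Suc_has_derivative[OF Suc.prems(1) assms(2)]])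
      from linear_Basis_expansion[OF this, of "frechet_derivative g (at x) v"] show ?thesis
        unfolding D_def real_scaleR_def .
    qed
    have "Ck_on k S (\<lambda>x. \<Sum>b\<in>Basis. (frechet_derivative g (at x) v \<bullet> b) *
        frechet_derivative f (at (g x)) b)"
    proof (intro Ck_on_sum Ck_on_mult Suc.IH[where f="\<lambda>y. frechet_derivative f (at y) b" for b] assms(1))
      show "Ck_on k S (\<lambda>x. frechet_derivative g (at x) v \<bullet> b)" for b
        by (rule Ck_on_bounded_linear_comp[OF bounded_linear_inner_left assms(1)])
          (use Suc.prems(2) in simp)
      show "Ck_on k T (\<lambda>y. frechet_derivative f (at y) b)" for b
        using Suc.prems(1) by simp
      show "Ck_on k S g" by (rule Ck_on_SucD[OF Suc.prems(2)])
    qed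
    then show "Ck_on k S (\<lambda>x. D x v)"
      by (rule Ck_on_cong) (use e assms in auto)
  qed
qed

section \<open>Smooth bump functions\<close>

text \<open>
The functions \<open>t\<^sup>-\<^sup>m exp (- 1 / t)\<close> on the positive half line, extended by zero. The span of this
family is closed under differentiation, so smoothness of all its members can be proved by one induction.
\<close>

definition flat :: "nat \<Rightarrow> real \<Rightarrow> real" where
  "flat m t = (if t \<le> 0 then 0 else inverse t ^ m * exp (- inverse t))"

lemma flat_has_derivative:
  "(flat m has_real_derivative - real m * flat (Suc m) t + flat (m + 2) t) (at t)"
proof (cases "t = 0")
  case True
  have l: "((\<lambda>y. (flat m y - flat m 0) / (y - 0)) \<longlongrightarrow> 0) (at_left 0)"
    by (rule tendsto_eventually) (auto simp: flat_def eventually_at_filter)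
  have "((\<lambda>s::real. s ^ Suc m / exp s) \<longlongrightarrow> 0) at_top" by (rule tendsto_power_div_exp_0)
  then have "((\<lambda>y::real. inverse y ^ Suc m / exp (inverse y)) \<longlongrightarrow> 0) (at_right 0)"
    using filterlim_compose filterlim_inverse_at_top_right by blast
  then have r: "((\<lambda>y. (flat m y - flat m 0) / (y - 0)) \<longlongrightarrow> 0) (at_right 0)"
    by (rule Lim_transform_eventually)
      (auto simp: flat_def eventually_at_filter exp_minus divide_simps)
  have "((\<lambda>y. (flat m y - flat m 0) / (y - 0)) \<longlongrightarrow> 0) (at 0)"
    using l r filterlim_split_at by blast
  then show ?thesis using True by (simp add: has_field_derivative_iff flat_def)
next
  case False
  show ?thesis
  proof (cases "t < 0")
    case True
    have "((\<lambda>_. 0) has_real_derivative 0) (at t)" by simp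
    then have "(flat m has_real_derivative 0) (at t)"
      by (rule has_field_derivative_transform_within_open[where S="{..<0}"])
        (use True in \<open>auto simp: flat_def\<close>)
    then show ?thesis using True by (simp add: flat_def)
  next
    case f: False
    then have t: "t > 0" using False by auto
    have "((\<lambda>t. inverse t ^ m * exp (- inverse t)) has_real_derivative
       - real m * (inverse t ^ Suc m * exp (- inverse t)) + inverse t ^ (m + 2) * exp (- inverse t)) (at t)"
    proof (rule DERIV_cong)
      have i: "(inverse has_real_derivative - (inverse t * inverse t)) (at t)"
        using DERIV_inverse[of t UNIV] t by (simp add: power2_eq_square)
      show "((\<lambda>t. inverse t ^ m * exp (- inverse t)) has_real_derivative
          of_nat m * (- (inverse t * inverse t) * inverse t ^ (m - Suc 0)) * exp (- inverse t)
          + exp (- inverse t) * - (- (inverse t * inverse t)) * inverse t ^ m) (at t)"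
        by (rule DERIV_mult[OF DERIV_power[OF i] DERIV_fun_exp[OF DERIV_minus[OF i]]])
    qed (cases m; simp add: algebra_simps)
    then have "(flat m has_real_derivative
       - real m * (inverse t ^ Suc m * exp (- inverse t)) + inverse t ^ (m + 2) * exp (- inverse t)) (at t)"
      by (rule has_field_derivative_transform_within_open[where S="{0<..}"])
        (use t in \<open>auto simp: flat_def\<close>)
    then show ?thesis using t by (simp add: flat_def)
  qed
qed

lemma Ck_on_flat: "Ck_on k UNIV (flat m)"
proof (induction k arbitrary: m)
  case 0
  have "isCont (flat m) t" for t using flat_has_derivative DERIV_isCont by blast
  then show ?case by (simp add: continuous_at_imp_continuous_on)
next
  case (Suc k)
  show ?case
  proof (rule Ck_on_SucI)
    show "(flat m has_derivative (\<lambda>v. (- real m * flat (Suc m) t + flat (m + 2) t) * v)) (at t)" for t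
      using flat_has_derivative[of m t] unfolding has_field_derivative_def .
    show "Ck_on k UNIV (\<lambda>t. (- real m * flat (Suc m) t + flat (m + 2) t) * v)" for v
      by (intro Ck_on_mult Ck_on_add Ck_on_const Suc.IH) auto
  qed auto
qed

lemma bump_function_exists:
  fixes a :: "'e::euclidean_space"
  assumes "\<rho> > 0"
  shows "\<exists>h::'e \<Rightarrow> real. Cinf_on UNIV h \<and> h a = 1 \<and> (\<forall>x. x \<notin> cball a \<rho> \<longrightarrow> h x = 0)"
proof -
  define h where "h x = flat 0 (\<rho>\<^sup>2 + (-1) * (\<Sum>b\<in>Basis. ((x + - a) \<bullet> b) * ((x + - a) \<bullet> b))) * inverse (flat 0 (\<rho>\<^sup>2))"
    for x :: 'e
  have s: "(\<Sum>b\<in>Basis. ((x + - a) \<bullet> b) * ((x + - a) \<bullet> b)) = (norm (x - a))\<^sup>2" for x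
    by (simp add: power2_norm_eq_inner euclidean_inner[of "x - a" "x - a"])
  have "Cinf_on UNIV h"
    unfolding Cinf_on_def h_def
  proof (intro allI Ck_on_mult Ck_on_const Ck_on_compose[OF _ open_UNIV _ Ck_on_flat])
    fix k
    have "Ck_on k (UNIV::'e set) (\<lambda>x. (x + - a) \<bullet> b)" for b
      by (intro Ck_on_bounded_linear_comp[OF bounded_linear_inner_left] Ck_on_add Ck_on_const
          Ck_on_bounded_linear bounded_linear_ident open_UNIV)
    then show "Ck_on k (UNIV::'e set) (\<lambda>x. \<rho>\<^sup>2 + (-1) * (\<Sum>b\<in>Basis. ((x + - a) \<bullet> b) * ((x + - a) \<bullet> b)))"
      by (intro Ck_on_add Ck_on_mult Ck_on_sum Ck_on_const open_UNIV)
  qed auto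
  moreover have "h a = 1" using assms by (simp add: h_def flat_def)
  moreover have "h x = 0" if "x \<notin> cball a \<rho>" for x
  proof -
    have "norm (x - a) > \<rho>" using that by (simp add: dist_norm norm_minus_commute)
    then have "\<rho>\<^sup>2 - (norm (x - a))\<^sup>2 \<le> 0" using assms by (simp add: power_mono)
    then show ?thesis unfolding h_def s by (simp add: flat_def)
  qed
  ultimately show ?thesis by blast
qed

section \<open>Hadamard's lemma\<close>

lemma segment_in_convex:
  assumes "convex B" "q \<in> B" "y \<in> B" "t \<in> cbox 0 (1::real)"
  shows "q + t *\<^sub>R (y - q) \<in> B"
proof -
  have "(1 - t) *\<^sub>R q + t *\<^sub>R y \<in> B" using assms by (intro convexD) auto
  then show ?thesis by (simp add: algebra_simps)
qed

lemma continuous_on_segment_pencil: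
  fixes G :: "'e::euclidean_space \<Rightarrow> real"
  assumes "convex B" "q \<in> B" "continuous_on B G"
  shows "continuous_on (B \<times> cbox 0 1) (\<lambda>(y, t). t ^ m * G (q + t *\<^sub>R (y - q)))"
proof -
  have "continuous_on (B \<times> cbox 0 1) (\<lambda>z. G (q + snd z *\<^sub>R (fst z - q)))"
    by (rule continuous_on_compose2[OF assms(3)])
      (use segment_in_convex[OF assms(1,2)] in \<open>auto intro!: continuous_intros\<close>)
  then show ?thesis unfolding case_prod_beta by (intro continuous_intros)
qed

text \<open>
Differentiation under the integral sign multiplies the integrand by \<open>t\<close>, because the inner derivative of
\<open>q + t (y - q)\<close> is multiplication by \<open>t\<close>. The weight \<open>t ^ m\<close> makes the claim stable under this step.
\<close>

lemma Ck_on_segment_integral: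
  fixes G :: "'e::euclidean_space \<Rightarrow> real"
  assumes "open B" "convex B" "q \<in> B" "Ck_on k B G"
  shows "Ck_on k B (\<lambda>y. integral (cbox 0 1) (\<lambda>t. t ^ m * G (q + t *\<^sub>R (y - q))))"
  using assms(4)
proof (induction k arbitrary: G m)
  case 0
  then show ?case
    using integral_continuous_on_param[OF continuous_on_segment_pencil[OF assms(2,3)]] by simp
next
  case (Suc k)
  define G' where "G' y = Blinfun (frechet_derivative G (at y))" for y
  have G: "(G has_derivative frechet_derivative G (at y)) (at y)" if "y \<in> B" for y
    by (rule Ck_on_Suc_has_derivative[OF Suc.prems assms(1) that])
  have G'_apply: "blinfun_apply (G' y) v = frechet_derivative G (at y) v" if "y \<in> B" for y v
    unfolding G'_def
    by (rule bounded_linear_Blinfun_apply[THEN fun_cong])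
      (use has_derivative_bounded_linear[OF G[OF that]] in simp)
  define fx where "fx y t = t ^ Suc m *\<^sub>R G' (q + t *\<^sub>R (y - q))" for y t
  have fx_apply: "blinfun_apply (fx y t) v = t ^ Suc m * frechet_derivative G (at (q + t *\<^sub>R (y - q))) v"
    if "y \<in> B" "t \<in> cbox 0 1" for y t v
    using G'_apply[OF segment_in_convex[OF assms(2,3) that]] by (simp add: fx_def scaleR_blinfun.rep_eq)
  have cont_dir: "continuous_on B (\<lambda>y. frechet_derivative G (at y) v)" for v
  proof -
    have "Ck_on k B (\<lambda>y. frechet_derivative G (at y) v)" using Suc.prems by simp
    then show ?thesis by (induction k) (auto simp: differentiable_imp_continuous_on)
  qed
  have cont_fx: "continuous_on (B \<times> cbox 0 1) (\<lambda>(y, t). fx y t)"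
  proof (rule continuous_on_blinfun_componentwise)
    fix v :: 'e
    show "continuous_on (B \<times> cbox 0 1) (\<lambda>z. blinfun_apply (case z of (y, t) \<Rightarrow> fx y t) v)"
      by (rule continuous_on_eq[OF continuous_on_segment_pencil[OF assms(2,3) cont_dir[of v], of "Suc m"]])
        (auto simp: fx_apply)
  qed
  have D: "((\<lambda>y. integral (cbox 0 1) (\<lambda>t. t ^ m * G (q + t *\<^sub>R (y - q)))) has_derivative
      (\<lambda>v. integral (cbox 0 1) (\<lambda>t. t ^ Suc m * frechet_derivative G (at (q + t *\<^sub>R (y - q))) v))) (at y)"
    if y: "y \<in> B" for y
  proof -
    have "((\<lambda>y. integral (cbox 0 1) (\<lambda>t. t ^ m * G (q + t *\<^sub>R (y - q)))) has_derivative
        blinfun_apply (integral (cbox 0 1) (fx y))) (at y within B)"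
    proof (rule leibniz_rule[OF _ _ cont_fx y assms(2)])
      fix y t assume yt: "y \<in> B" "t \<in> cbox 0 (1::real)"
      have "((\<lambda>y. q + t *\<^sub>R (y - q)) has_derivative (\<lambda>v. t *\<^sub>R v)) (at y)"
        by (auto intro!: derivative_eq_intros)
      from has_derivative_compose[OF this G[OF segment_in_convex[OF assms(2,3) yt]]]
      have "((\<lambda>y. t ^ m * G (q + t *\<^sub>R (y - q))) has_derivative
          (\<lambda>v. t ^ m * frechet_derivative G (at (q + t *\<^sub>R (y - q))) (t *\<^sub>R v))) (at y)"
        by (rule has_derivative_mult_right)
      moreover have "t ^ m * frechet_derivative G (at (q + t *\<^sub>R (y - q))) (t *\<^sub>R v) = blinfun_apply (fx y t) v" for v
        using linear_scale[OF has_derivative_linear[OF G[OF segment_in_convex[OF assms(2,3) yt]]], of t v]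
        by (simp add: fx_apply[OF yt])
      ultimately show "((\<lambda>y. t ^ m * G (q + t *\<^sub>R (y - q))) has_derivative blinfun_apply (fx y t)) (at y within B)"
        by (simp add: has_derivative_at_withinI)
    next
      fix y assume "y \<in> B"
      have "continuous_on (cbox 0 1) (\<lambda>t. t ^ m * G (q + t *\<^sub>R (y - q)))"
      proof -
        have "continuous_on B G" using Suc.prems by (simp add: differentiable_imp_continuous_on)
        note pencil = continuous_on_segment_pencil[OF assms(2,3) this, of m]
        have "continuous_on (cbox 0 1) (\<lambda>t::real. (y, t))" by (intro continuous_intros)
        from continuous_on_compose2[OF pencil this] \<open>y \<in> B\<close> show ?thesis by auto
      qed
      then show "(\<lambda>t. t ^ m * G (q + t *\<^sub>R (y - q))) integrable_on cbox 0 1"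
        by (rule integrable_continuous)
    qed
    moreover have "blinfun_apply (integral (cbox 0 1) (fx y)) v =
        integral (cbox 0 1) (\<lambda>t. t ^ Suc m * frechet_derivative G (at (q + t *\<^sub>R (y - q))) v)" for v
    proof -
      have "continuous_on (cbox 0 1) (fx y)"
      proof -
        have "continuous_on (cbox 0 1) (\<lambda>t::real. (y, t))" by (intro continuous_intros)
        from continuous_on_compose2[OF cont_fx this] y show ?thesis by auto
      qed
      then have "fx y integrable_on cbox 0 1" by (rule integrable_continuous)
      then have "blinfun_apply (integral (cbox 0 1) (fx y)) v = integral (cbox 0 1) (\<lambda>t. blinfun_apply (fx y t) v)"
        by (rule blinfun_apply_integral)
      also have "\<dots> = integral (cbox 0 1) (\<lambda>t. t ^ Suc m * frechet_derivative G (at (q + t *\<^sub>R (y - q))) v)"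
        by (rule integral_cong) (rule fx_apply[OF y])
      finally show ?thesis .
    qed
    ultimately show ?thesis unfolding at_within_open[OF y assms(1)]
      by (rule has_derivative_eq_rhs[OF _ ext])
  qed
  show ?case
    by (rule Ck_on_SucI[OF assms(1) D Suc.IH]) (use Suc.prems in simp_all)
qed

text \<open>
The fundamental theorem of calculus along the segment from \<open>q\<close> to \<open>y\<close>; the factors are the averages of the
partial derivatives over that segment.
\<close>

lemma Hadamard_lemma:
  fixes F :: "'e::euclidean_space \<Rightarrow> real"
  assumes "open B" "convex B" "q \<in> B" "Cinf_on B F"
  obtains H :: "'e \<Rightarrow> 'e \<Rightarrow> real" where
    "\<And>b. Cinf_on B (H b)"
    "\<And>y. y \<in> B \<Longrightarrow> F y = F q + (\<Sum>b\<in>Basis. ((y - q) \<bullet> b) * H b y)"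
    "\<And>b. H b q = frechet_derivative F (at q) b"
proof
  define H where "H b y = integral (cbox 0 1) (\<lambda>t. t ^ 0 * frechet_derivative F (at (q + t *\<^sub>R (y - q))) b)"
    for b y
  have C1: "Ck_on k B (\<lambda>y. frechet_derivative F (at y) v)" for k v
    using assms(4) unfolding Cinf_on_def by (metis Ck_on.simps(2))
  have F: "(F has_derivative frechet_derivative F (at y)) (at y)" if "y \<in> B" for y
    using Ck_on_Suc_has_derivative[OF _ assms(1) that, of 0] assms(4) unfolding Cinf_on_def by blast
  show "Cinf_on B (H b)" for b
    unfolding H_def Cinf_on_def by (intro allI Ck_on_segment_integral assms C1)
  show "H b q = frechet_derivative F (at q) b" for b
    by (simp add: H_def)
  show "F y = F q + (\<Sum>b\<in>Basis. ((y - q) \<bullet> b) * H b y)" if y: "y \<in> B" for y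
  proof -
    have "((\<lambda>t. frechet_derivative F (at (q + t *\<^sub>R (y - q))) (y - q)) has_integral
        F (q + 1 *\<^sub>R (y - q)) - F (q + 0 *\<^sub>R (y - q))) {0..1}"
    proof (rule fundamental_theorem_of_calculus)
      fix t :: real assume "t \<in> {0..1}"
      then have s: "q + t *\<^sub>R (y - q) \<in> B" using segment_in_convex[OF assms(2,3) y] by simp
      have "((\<lambda>t. q + t *\<^sub>R (y - q)) has_derivative (\<lambda>h. h *\<^sub>R (y - q))) (at t within {0..1})"
        by (auto intro!: derivative_eq_intros)
      from has_derivative_compose[OF this F[OF s]]
      show "((\<lambda>t. F (q + t *\<^sub>R (y - q))) has_vector_derivative
          frechet_derivative F (at (q + t *\<^sub>R (y - q))) (y - q)) (at t within {0..1})"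
        unfolding has_vector_derivative_def
        using linear_scale[OF has_derivative_linear[OF F[OF s]]] by simp
    qed simp
    then have i: "F y - F q = integral (cbox 0 1) (\<lambda>t. frechet_derivative F (at (q + t *\<^sub>R (y - q))) (y - q))"
      by (auto dest!: integral_unique)
    have c: "continuous_on (cbox 0 1) (\<lambda>t::real. frechet_derivative F (at (q + t *\<^sub>R (y - q))) b)" for b
      by (rule continuous_on_compose2[where g="\<lambda>y. frechet_derivative F (at y) b" and t=B])
        (use C1[of 0 b] segment_in_convex[OF assms(2,3) y] in \<open>auto intro!: continuous_intros\<close>)
    have "integral (cbox 0 1) (\<lambda>t. frechet_derivative F (at (q + t *\<^sub>R (y - q))) (y - q)) =
        integral (cbox 0 1) (\<lambda>t. \<Sum>b\<in>Basis. ((y - q) \<bullet> b) * frechet_derivative F (at (q + t *\<^sub>R (y - q))) b)"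
    proof (rule integral_cong)
      fix t :: real assume "t \<in> cbox 0 1"
      from linear_Basis_expansion[OF has_derivative_linear[OF F[OF segment_in_convex[OF assms(2,3) y this]]], of "y - q"]
      show "frechet_derivative F (at (q + t *\<^sub>R (y - q))) (y - q) =
        (\<Sum>b\<in>Basis. ((y - q) \<bullet> b) * frechet_derivative F (at (q + t *\<^sub>R (y - q))) b)" by simp
    qed
    also have "\<dots> = (\<Sum>b\<in>Basis. ((y - q) \<bullet> b) * H b y)"
      unfolding H_def
      by (subst integral_sum)
        (simp_all, intro integrable_continuous_interval continuous_intros c[simplified])
    finally show ?thesis using i by simp
  qed
qed

section \<open>Smooth functions and vector fields on a manifold\<close>

lemma Cinf_on_mult:
  fixes f g :: "'e::real_normed_vector \<Rightarrow> real"
  shows "open S \<Longrightarrow> Cinf_on S f \<Longrightarrow> Cinf_on S g \<Longrightarrow> Cinf_on S (\<lambda>x. f x * g x)"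
  by (simp add: Cinf_on_def Ck_on_mult)

lemma Cinf_on_subset: "Cinf_on T f \<Longrightarrow> open T \<Longrightarrow> S \<subseteq> T \<Longrightarrow> Cinf_on S f"
  unfolding Cinf_on_def using Ck_on_subset by blast

lemma Cinf_on_directional_derivative:
  "Cinf_on S f \<Longrightarrow> Cinf_on S (\<lambda>x. frechet_derivative f (at x) v)"
  unfolding Cinf_on_def by (metis Ck_on.simps(2))

lemma Cinf_on_has_derivative:
  "Cinf_on S f \<Longrightarrow> open S \<Longrightarrow> x \<in> S \<Longrightarrow> (f has_derivative frechet_derivative f (at x)) (at x)"
  unfolding Cinf_on_def using Ck_on_Suc_has_derivative[of 0] by blast

lemma sum_fun_apply: "(\<Sum>i\<in>I. f i) x = (\<Sum>i\<in>I. f i x)"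
  for f :: "'i \<Rightarrow> 'a \<Rightarrow> 'b::comm_monoid_add"
  by (induction I rule: infinite_finite_induct) auto

lemma fscale_apply [simp]: "(f \<odot> X) h p = f p * X h p"
  by (simp add: fscale_def)

locale manifold =
  fixes M :: "('a::{t2_space, second_countable_topology}, 'e::euclidean_space) atlas"
  assumes smooth_manifold: "smooth_manifold M"
begin

lemma chart: "(U, c) \<in> M \<Longrightarrow> open U \<and> open (c ` U) \<and> homeomorphism U (c ` U) c (inv_into U c)"
  using smooth_manifold[unfolded smooth_manifold_def, THEN conjunct2, THEN conjunct1, THEN bspec, of "(U, c)"]
  by simp

lemma open_chart: "(U, c) \<in> M \<Longrightarrow> open U" "(U, c) \<in> M \<Longrightarrow> open (c ` U)"
  using chart by simp_all

lemma homeomorphism_chart: "(U, c) \<in> M \<Longrightarrow> homeomorphism U (c ` U) c (inv_into U c)"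
  using chart by simp

lemma inv_chart [simp]: "(U, c) \<in> M \<Longrightarrow> q \<in> U \<Longrightarrow> inv_into U c (c q) = q"
  using homeomorphism_chart unfolding homeomorphism_def by simp

lemma chart_at: obtains U c where "(U, c) \<in> M" "p \<in> U"
proof -
  have "p \<in> (\<Union>(U, c)\<in>M. U)"
    using smooth_manifold[unfolded smooth_manifold_def, THEN conjunct1] by simp
  then show ?thesis using that by auto
qed

lemma transition_smooth:
  assumes "(U, c) \<in> M" "(V, d) \<in> M"
  shows "Cinf_on (c ` (U \<inter> V)) (d \<circ> inv_into U c)"
proof -
  have "\<forall>(U, c)\<in>M. \<forall>(V, d)\<in>M. Cinf_on (c ` (U \<inter> V)) (d \<circ> inv_into U c)"
    using smooth_manifold unfolding smooth_manifold_def by simp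
  from bspec[OF this assms(1)] have "\<forall>(V, d)\<in>M. Cinf_on (c ` (U \<inter> V)) (d \<circ> inv_into U c)" by simp
  from bspec[OF this assms(2)] show ?thesis by simp
qed

lemma open_chart_image:
  assumes "(U, c) \<in> M" "open N"
  shows "open (c ` (U \<inter> N))"
proof -
  have "openin (top_of_set U) (U \<inter> N)" using assms(2) by blast
  then have "openin (top_of_set (c ` U)) (c ` (U \<inter> N))"
    by (rule homeomorphism_imp_open_map[OF homeomorphism_chart[OF assms(1)]])
  then show ?thesis using open_chart(2)[OF assms(1)] openin_open_eq by blast
qed

lemma open_chart_preimage:
  assumes "(U, c) \<in> M" "open B"
  shows "open {q \<in> U. c q \<in> B}"
proof -
  have "continuous_on U c" using homeomorphism_chart[OF assms(1)] by (simp add: homeomorphism_def)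
  from continuous_open_preimage[OF this open_chart(1)[OF assms(1)] assms(2)]
  show ?thesis by (simp add: vimage_def Int_def)
qed

abbreviation "\<F> \<equiv> smooth_functions M"
abbreviation "\<X> \<equiv> vector_fields M"

lemma smooth_functions_chart:
  "f \<in> \<F> \<Longrightarrow> (U, c) \<in> M \<Longrightarrow> Cinf_on (c ` U) (f \<circ> inv_into U c)"
  unfolding smooth_functions_def by auto

lemma smooth_functionsI:
  "(\<And>U c k. (U, c) \<in> M \<Longrightarrow> Ck_on k (c ` U) (\<lambda>y. f (inv_into U c y))) \<Longrightarrow> f \<in> \<F>"
  unfolding smooth_functions_def Cinf_on_def comp_def by auto

lemma smooth_functionsD:
  "f \<in> \<F> \<Longrightarrow> (U, c) \<in> M \<Longrightarrow> Ck_on k (c ` U) (\<lambda>y. f (inv_into U c y))"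
  unfolding smooth_functions_def Cinf_on_def comp_def by auto

lemma smooth_const [intro, simp]: "(\<lambda>_. k) \<in> \<F>"
  by (rule smooth_functionsI) (intro Ck_on_const open_chart(2))

lemma smooth_add [intro, simp]: "f \<in> \<F> \<Longrightarrow> h \<in> \<F> \<Longrightarrow> f + h \<in> \<F>"
  by (rule smooth_functionsI, unfold plus_fun_def,
      rule Ck_on_add[OF open_chart(2) smooth_functionsD smooth_functionsD])

lemma smooth_mult [intro, simp]: "f \<in> \<F> \<Longrightarrow> h \<in> \<F> \<Longrightarrow> f * h \<in> \<F>"
  by (rule smooth_functionsI, unfold times_fun_def,
      rule Ck_on_mult[OF open_chart(2) smooth_functionsD smooth_functionsD])

lemma smooth_scale [intro, simp]: "f \<in> \<F> \<Longrightarrow> (\<lambda>p. k * f p) \<in> \<F>"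
  using smooth_mult[OF smooth_const[of k]] by (simp add: times_fun_def)

lemma smooth_zero [intro, simp]: "0 \<in> \<F>"
  using smooth_const[of 0] by (simp add: zero_fun_def)

lemma smooth_minus [intro, simp]: "f \<in> \<F> \<Longrightarrow> - f \<in> \<F>"
  using smooth_scale[of f "-1"] by (simp add: fun_Compl_def)

lemma smooth_diff [intro, simp]: "f \<in> \<F> \<Longrightarrow> h \<in> \<F> \<Longrightarrow> f - h \<in> \<F>"
  using smooth_add[of f "- h"] by simp

lemma smooth_sum [intro]: "(\<And>i. i \<in> I \<Longrightarrow> f i \<in> \<F>) \<Longrightarrow> (\<Sum>i\<in>I. f i) \<in> \<F>"
  by (induction I rule: infinite_finite_induct) auto

definition extend_zero :: "'a set \<Rightarrow> ('a \<Rightarrow> 'e) \<Rightarrow> 'e set \<Rightarrow> ('e \<Rightarrow> real) \<Rightarrow> 'a \<Rightarrow> real" where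
  "extend_zero U c B h q = (if q \<in> U \<and> c q \<in> B then h (c q) else 0)"

text \<open>
Near a point with coordinates in \<open>B\<close> the extension is a composition with a change of charts. The
preimage of the compact set \<open>K\<close> is compact, hence closed because the manifold is Hausdorff, so every other
point has a neighbourhood on which the extension vanishes.
\<close>

lemma extend_zero_smooth:
  assumes "(U, c) \<in> M" "open B" "B \<subseteq> c ` U" "compact K" "K \<subseteq> B"
    and "Cinf_on B h" and "\<And>y. y \<in> B - K \<Longrightarrow> h y = 0"
  shows "extend_zero U c B h \<in> \<F>"
proof (rule smooth_functionsI)
  fix V d k assume V: "(V, d) \<in> M"
  define W where "W = {q \<in> U. c q \<in> B}"
  have "open W" unfolding W_def by (rule open_chart_preimage[OF assms(1,2)])
  define K' where "K' = inv_into U c ` K"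
  have "continuous_on (c ` U) (inv_into U c)"
    using homeomorphism_chart[OF assms(1)] by (simp add: homeomorphism_def)
  then have "continuous_on K (inv_into U c)"
    by (rule continuous_on_subset) (use assms in blast)
  then have "closed K'" unfolding K'_def
    by (intro compact_imp_closed compact_continuous_image assms(4))
  show "Ck_on k (d ` V) (\<lambda>y. extend_zero U c B h (inv_into V d y))"
  proof (rule Ck_on_local)
    fix y assume "y \<in> d ` V"
    then obtain q where q: "q \<in> V" "y = d q" by blast
    show "\<exists>N. open N \<and> y \<in> N \<and> Ck_on k N (\<lambda>y. extend_zero U c B h (inv_into V d y))"
    proof (cases "q \<in> W")
      case True
      define N where "N = d ` (V \<inter> W)"
      have oN: "open N" unfolding N_def by (rule open_chart_image[OF V \<open>open W\<close>])
      have "Ck_on k (d ` (V \<inter> U)) (\<lambda>y. c (inv_into V d y))"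
        using transition_smooth[OF V assms(1)] by (simp add: Cinf_on_def comp_def)
      then have ck: "Ck_on k N (\<lambda>y. c (inv_into V d y))"
        by (rule Ck_on_subset) (use open_chart_image[OF V] open_chart assms(1) in \<open>auto simp: N_def W_def\<close>)
      have "Ck_on k N (\<lambda>y. h (c (inv_into V d y)))"
        by (rule Ck_on_compose[OF oN assms(2) _ _ ck])
          (use V assms(6) in \<open>auto simp: N_def W_def Cinf_on_def\<close>)
      then have "Ck_on k N (\<lambda>y. extend_zero U c B h (inv_into V d y))"
        by (rule Ck_on_cong[OF _ oN]) (use V in \<open>auto simp: N_def W_def extend_zero_def\<close>)
      then show ?thesis using oN q True by (auto simp: N_def)
    next
      case False
      define N where "N = d ` (V \<inter> - K')"
      have oN: "open N" unfolding N_def by (rule open_chart_image[OF V]) (use \<open>closed K'\<close> in auto)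
      have "q \<notin> K'"
      proof
        assume "q \<in> K'"
        then obtain y where "y \<in> K" "q = inv_into U c y" by (auto simp: K'_def)
        moreover have "y \<in> c ` U" using \<open>y \<in> K\<close> assms(3,5) by blast
        ultimately have "q \<in> U" "c q = y" by (simp_all add: inv_into_into f_inv_into_f)
        then show False using False \<open>y \<in> K\<close> assms(5) by (auto simp: W_def)
      qed
      have "Ck_on k N (\<lambda>y. 0)" by (rule Ck_on_const[OF oN])
      then have "Ck_on k N (\<lambda>y. extend_zero U c B h (inv_into V d y))"
      proof (rule Ck_on_cong[OF _ oN])
        fix y assume "y \<in> N"
        then obtain q' where q': "q' \<in> V" "q' \<notin> K'" "y = d q'" by (auto simp: N_def)
        have "c q' \<notin> K" if "q' \<in> U"
          using q'(2) inv_chart[OF assms(1) that] unfolding K'_def by (metis imageI)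
        then show "0 = extend_zero U c B h (inv_into V d y)"
          using q' V assms(7) by (auto simp: extend_zero_def)
      qed
      then show ?thesis using oN q \<open>q \<notin> K'\<close> by (auto simp: N_def)
    qed
  qed
qed

lemmas vector_fields_conj = vector_fields_def[THEN equalityD1, THEN subsetD, THEN CollectD]

lemma vf_smooth: "X \<in> \<X> \<Longrightarrow> f \<in> \<F> \<Longrightarrow> X f \<in> \<F>"
  by (rule vector_fields_conj[THEN conjunct1, rule_format])

lemma vf_add: "X \<in> \<X> \<Longrightarrow> f \<in> \<F> \<Longrightarrow> h \<in> \<F> \<Longrightarrow> X (f + h) = X f + X h"
  by (rule vector_fields_conj[THEN conjunct2, THEN conjunct1, rule_format])

lemma vf_scale: "X \<in> \<X> \<Longrightarrow> f \<in> \<F> \<Longrightarrow> X (\<lambda>p. k * f p) = (\<lambda>p. k * X f p)"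
  by (rule vector_fields_conj[THEN conjunct2, THEN conjunct2, THEN conjunct1, rule_format])

lemma vf_mult: "X \<in> \<X> \<Longrightarrow> f \<in> \<F> \<Longrightarrow> h \<in> \<F> \<Longrightarrow> X (f * h) = X f * h + f * X h"
  by (rule vector_fields_conj[THEN conjunct2, THEN conjunct2, THEN conjunct2, THEN conjunct1, rule_format])

lemma vf_nonsmooth: "X \<in> \<X> \<Longrightarrow> f \<notin> \<F> \<Longrightarrow> X f = 0"
  by (rule vector_fields_conj[THEN conjunct2, THEN conjunct2, THEN conjunct2, THEN conjunct2, rule_format])

lemma vector_fieldsI:
  assumes "\<And>f. f \<in> \<F> \<Longrightarrow> X f \<in> \<F>"
    and "\<And>f h. f \<in> \<F> \<Longrightarrow> h \<in> \<F> \<Longrightarrow> X (f + h) = X f + X h"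
    and "\<And>f k. f \<in> \<F> \<Longrightarrow> X (\<lambda>p. k * f p) = (\<lambda>p. k * X f p)"
    and "\<And>f h. f \<in> \<F> \<Longrightarrow> h \<in> \<F> \<Longrightarrow> X (f * h) = X f * h + f * X h"
    and "\<And>f. f \<notin> \<F> \<Longrightarrow> X f = 0"
  shows "X \<in> \<X>"
  unfolding vector_fields_def mem_Collect_eq by (intro conjI ballI allI impI assms)

lemma vf_zero_arg: "X \<in> \<X> \<Longrightarrow> X 0 = 0"
  using vf_scale[of X 0 0] by (simp add: zero_fun_def)

lemma vf_diff:
  assumes "X \<in> \<X>" "f \<in> \<F>" "h \<in> \<F>"
  shows "X (f - h) = X f - X h"
proof -
  have "X f = X ((f - h) + h)" by simp
  also have "\<dots> = X (f - h) + X h" by (rule vf_add[OF assms(1) smooth_diff[OF assms(2,3)] assms(3)])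
  finally show ?thesis by simp
qed

lemma vf_sum: "X \<in> \<X> \<Longrightarrow> (\<And>i. i \<in> I \<Longrightarrow> f i \<in> \<F>) \<Longrightarrow> X (\<Sum>i\<in>I. f i) = (\<Sum>i\<in>I. X (f i))"
  by (induction I rule: infinite_finite_induct) (auto simp: smooth_sum vf_zero_arg vf_add)

lemma vf_const: "X \<in> \<X> \<Longrightarrow> X (\<lambda>_. k) = 0"
proof -
  assume X: "X \<in> \<X>"
  have "X (1 * 1) = X 1 * 1 + 1 * X 1"
    by (rule vf_mult[OF X]) (auto simp: one_fun_def)
  then have "X 1 = 0" by simp
  then show ?thesis using vf_scale[OF X, of 1 k] by (simp add: one_fun_def zero_fun_def)
qed

text \<open>
Outside the smooth functions every vector field is zero, so smooth arguments suffice.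
\<close>

lemma vf_eqI: "X \<in> \<X> \<Longrightarrow> Y \<in> \<X> \<Longrightarrow> (\<And>f p. f \<in> \<F> \<Longrightarrow> X f p = Y f p) \<Longrightarrow> X = Y"
  by (rule ext, rule ext) (metis vf_nonsmooth)

lemma zero_vf [intro, simp]: "0 \<in> \<X>"
  by (rule vector_fieldsI) (auto simp: fun_eq_iff)

lemma add_vf [intro, simp]:
  assumes X: "X \<in> \<X>" and Y: "Y \<in> \<X>"
  shows "X + Y \<in> \<X>"
proof (rule vector_fieldsI)
  fix f assume f: "f \<in> \<F>"
  show "(X + Y) f \<in> \<F>"
    unfolding plus_fun_apply[of X Y] by (intro smooth_add vf_smooth[OF X] vf_smooth[OF Y] f)
  show "(X + Y) (\<lambda>p. k * f p) = (\<lambda>p. k * (X + Y) f p)" for k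
    by (simp add: vf_scale[OF X f] vf_scale[OF Y f] fun_eq_iff algebra_simps)
  fix h assume h: "h \<in> \<F>"
  show "(X + Y) (f + h) = (X + Y) f + (X + Y) h"
    by (simp add: vf_add[OF X f h] vf_add[OF Y f h] ac_simps)
  show "(X + Y) (f * h) = (X + Y) f * h + f * (X + Y) h"
    by (simp add: vf_mult[OF X f h] vf_mult[OF Y f h] algebra_simps)
next
  fix f assume f: "f \<notin> \<F>"
  show "(X + Y) f = 0" by (simp add: vf_nonsmooth[OF X f] vf_nonsmooth[OF Y f])
qed

lemma fscale_vf [intro, simp]:
  assumes u: "u \<in> \<F>" and X: "X \<in> \<X>"
  shows "u \<odot> X \<in> \<X>"
proof (rule vector_fieldsI)
  fix f assume f: "f \<in> \<F>"
  show "(u \<odot> X) f \<in> \<F>" unfolding fscale_def by (intro smooth_mult vf_smooth[OF X] u f)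
  show "(u \<odot> X) (\<lambda>p. k * f p) = (\<lambda>p. k * (u \<odot> X) f p)" for k
    by (simp add: fscale_def vf_scale[OF X f] fun_eq_iff)
  fix h assume h: "h \<in> \<F>"
  show "(u \<odot> X) (f + h) = (u \<odot> X) f + (u \<odot> X) h"
    by (simp add: fscale_def vf_add[OF X f h] algebra_simps)
  show "(u \<odot> X) (f * h) = (u \<odot> X) f * h + f * (u \<odot> X) h"
    by (simp add: fscale_def vf_mult[OF X f h] algebra_simps)
next
  fix f assume f: "f \<notin> \<F>"
  show "(u \<odot> X) f = 0" by (simp add: fscale_def vf_nonsmooth[OF X f])
qed

lemma uminus_eq_fscale: "- X = (\<lambda>_. -1) \<odot> X" for X :: "'a vfield"
  by (simp add: fscale_def fun_eq_iff)

lemma uminus_vf [intro, simp]: "X \<in> \<X> \<Longrightarrow> - X \<in> \<X>"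
  by (simp add: uminus_eq_fscale)

lemma diff_vf [intro, simp]: "X \<in> \<X> \<Longrightarrow> Y \<in> \<X> \<Longrightarrow> X - Y \<in> \<X>"
  using add_vf[of X "- Y"] by simp

lemma sum_vf [intro]: "(\<And>i. i \<in> I \<Longrightarrow> X i \<in> \<X>) \<Longrightarrow> (\<Sum>i\<in>I. X i) \<in> \<X>"
  by (induction I rule: infinite_finite_induct) auto

lemma lie_bracket_vf [intro, simp]:
  assumes X: "X \<in> \<X>" and Y: "Y \<in> \<X>"
  shows "lie_bracket X Y \<in> \<X>"
proof (rule vector_fieldsI)
  fix f assume f: "f \<in> \<F>"
  note f' = f vf_smooth[OF X f] vf_smooth[OF Y f]
  show "lie_bracket X Y f \<in> \<F>"
    unfolding lie_bracket_def by (intro smooth_diff vf_smooth[OF X] vf_smooth[OF Y] f)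
  show "lie_bracket X Y (\<lambda>p. k * f p) = (\<lambda>p. k * lie_bracket X Y f p)" for k
    by (simp add: lie_bracket_def vf_scale[OF X] vf_scale[OF Y] f' fun_eq_iff algebra_simps)
  fix h assume h: "h \<in> \<F>"
  note s = f' h vf_smooth[OF X h] vf_smooth[OF Y h]
  show "lie_bracket X Y (f + h) = lie_bracket X Y f + lie_bracket X Y h"
    by (simp add: lie_bracket_def vf_add[OF X] vf_add[OF Y] s algebra_simps)
  show "lie_bracket X Y (f * h) = lie_bracket X Y f * h + f * lie_bracket X Y h"
    by (simp add: lie_bracket_def vf_add[OF X] vf_add[OF Y] vf_mult[OF X] vf_mult[OF Y] s algebra_simps)
next
  fix f assume f: "f \<notin> \<F>"
  show "lie_bracket X Y f = 0"
    by (simp add: lie_bracket_def vf_nonsmooth[OF X f] vf_nonsmooth[OF Y f] vf_zero_arg X Y)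
qed

lemma one_form_smooth:
  assumes "one_form M \<omega>" "X \<in> \<X>"
  shows "\<omega> X \<in> \<F>"
  by (rule one_form_def[THEN iffD1, OF assms(1), THEN conjunct1, rule_format, OF assms(2)])

lemma one_form_add:
  assumes "one_form M \<omega>" "X \<in> \<X>" "Y \<in> \<X>"
  shows "\<omega> (X + Y) = \<omega> X + \<omega> Y"
  by (rule one_form_def[THEN iffD1, OF assms(1), THEN conjunct2, THEN conjunct1, rule_format, OF assms(2) assms(3)])

lemma one_form_fscale:
  assumes "one_form M \<omega>" "f \<in> \<F>" "X \<in> \<X>"
  shows "\<omega> (f \<odot> X) = f * \<omega> X"
  by (rule one_form_def[THEN iffD1, OF assms(1), THEN conjunct2, THEN conjunct2, rule_format, OF assms(2) assms(3)])

lemma one_formI: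
  assumes "\<And>X. X \<in> \<X> \<Longrightarrow> \<omega> X \<in> \<F>"
    and "\<And>X Y. X \<in> \<X> \<Longrightarrow> Y \<in> \<X> \<Longrightarrow> \<omega> (X + Y) = \<omega> X + \<omega> Y"
    and "\<And>f X. f \<in> \<F> \<Longrightarrow> X \<in> \<X> \<Longrightarrow> \<omega> (f \<odot> X) = f * \<omega> X"
  shows "one_form M \<omega>"
  unfolding one_form_def by (intro conjI ballI assms)

lemma tensor11_vf:
  assumes "tensor11 M T" "X \<in> \<X>"
  shows "T X \<in> \<X>"
  by (rule tensor11_def[THEN iffD1, OF assms(1), THEN conjunct1, rule_format, OF assms(2)])

lemma tensor11_add:
  assumes "tensor11 M T" "X \<in> \<X>" "Y \<in> \<X>"
  shows "T (X + Y) = T X + T Y"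
  by (rule tensor11_def[THEN iffD1, OF assms(1), THEN conjunct2, THEN conjunct1, rule_format, OF assms(2) assms(3)])

lemma tensor11_fscale:
  assumes "tensor11 M T" "f \<in> \<F>" "X \<in> \<X>"
  shows "T (f \<odot> X) = f \<odot> T X"
  by (rule tensor11_def[THEN iffD1, OF assms(1), THEN conjunct2, THEN conjunct2, rule_format, OF assms(2) assms(3)])

lemma tensor11I:
  assumes "\<And>X. X \<in> \<X> \<Longrightarrow> T X \<in> \<X>"
    and "\<And>X Y. X \<in> \<X> \<Longrightarrow> Y \<in> \<X> \<Longrightarrow> T (X + Y) = T X + T Y"
    and "\<And>f X. f \<in> \<F> \<Longrightarrow> X \<in> \<X> \<Longrightarrow> T (f \<odot> X) = f \<odot> T X"
  shows "tensor11 M T"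
  unfolding tensor11_def by (intro conjI ballI assms)

lemma one_form_zero: "one_form M \<omega> \<Longrightarrow> \<omega> 0 = 0"
  using one_form_add[of \<omega> 0 0] by simp

lemma one_form_sum:
  "one_form M \<omega> \<Longrightarrow> (\<And>i. i \<in> I \<Longrightarrow> X i \<in> \<X>) \<Longrightarrow> \<omega> (\<Sum>i\<in>I. X i) = (\<Sum>i\<in>I. \<omega> (X i))"
  by (induction I rule: infinite_finite_induct) (auto simp: one_form_zero one_form_add sum_vf)

lemma one_form_evaluation: "f \<in> \<F> \<Longrightarrow> one_form M (\<lambda>X. X f)"
  by (rule one_formI) (simp_all add: fscale_def vf_smooth)

lemma one_form_tensor11: "tensor11 M T \<Longrightarrow> f \<in> \<F> \<Longrightarrow> one_form M (\<lambda>X. T X f)"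
  by (rule one_formI) (simp_all add: tensor11_vf tensor11_add tensor11_fscale fun_eq_iff vf_smooth)




end

section \<open>Tangent vectors and the values of tensors at a point\<close>

text \<open>
Functions \<open>u b\<close> and vector fields \<open>E b\<close> that play the role of coordinates and coordinate fields at \<open>p\<close>,
but are defined on the whole manifold. The last assumption says that the value of a one-form at \<open>p\<close>
depends only on the tangent vector at \<open>p\<close> and that the fields \<open>E b\<close> span the tangent space.
\<close>

locale tangent_frame = manifold M
  for M :: "('a::{t2_space, second_countable_topology}, 'e::euclidean_space) atlas" +
  fixes p :: 'a and u :: "'e \<Rightarrow> 'a \<Rightarrow> real" and E :: "'e \<Rightarrow> 'a vfield"
  assumes u_smooth: "\<And>b. u b \<in> smooth_functions M"
    and E_vf: "\<And>b. E b \<in> vector_fields M"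
    and E_u: "\<And>b b'. b \<in> Basis \<Longrightarrow> b' \<in> Basis \<Longrightarrow> E b (u b') p = (if b = b' then 1 else 0)"
    and one_form_frame: "\<And>\<omega> X. one_form M \<omega> \<Longrightarrow> X \<in> vector_fields M \<Longrightarrow>
      \<omega> X p = (\<Sum>b\<in>Basis. X (u b) p * \<omega> (E b) p)"

context manifold
begin

text \<open>
With a bump function \<open>\<theta>\<close> supported in a coordinate ball, take \<open>u b = \<theta> \<cdot> (x b - x b (p))\<close> and
\<open>E b = \<theta> \<cdot> \<partial> / \<partial> x b\<close>. The heart of the proof is an identity of global vector fields,
\<open>\<theta>\<^sup>3 X = \<Sum>b. (\<theta> \<cdot> X (u b) - u b \<cdot> X \<theta>) E b\<close>, to which any one-form can be applied. The
additional powers of \<open>\<theta>\<close> make every function in it globally defined and smooth.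
\<close>

lemma tangent_frame_exists: obtains u E where "tangent_frame M p u E"
proof -
  obtain U c where Uc: "(U, c) \<in> M" and pU: "p \<in> U" by (rule chart_at)
  obtain r where r: "r > 0" "ball (c p) r \<subseteq> c ` U"
    using open_contains_ball_eq[OF open_chart(2)[OF Uc]] pU by blast
  define B where "B = ball (c p) r"
  define K where "K = cball (c p) (r / 2)"
  have B: "open B" "convex B" "B \<subseteq> c ` U" "c p \<in> B" and K: "compact K" "K \<subseteq> B"
    using r by (auto simp: B_def K_def)
  have "r / 2 > 0" using r by simp
  from bump_function_exists[OF this, of "c p"] obtain h :: "'e \<Rightarrow> real" where
    "Cinf_on UNIV h \<and> h (c p) = 1 \<and> (\<forall>x. x \<notin> cball (c p) (r / 2) \<longrightarrow> h x = 0)" ..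
  then have h: "Cinf_on UNIV h" "h (c p) = 1" "\<And>x. x \<notin> K \<Longrightarrow> h x = 0"
    by (simp_all add: K_def)
  have hB: "Cinf_on B h" by (rule Cinf_on_subset[OF h(1)]) auto
  let ?ext = "extend_zero U c B"
  have ext: "?ext (\<lambda>y. h y * f y) \<in> \<F>" if "Cinf_on B f" for f
    by (rule extend_zero_smooth[OF Uc B(1,3) K Cinf_on_mult[OF B(1) hB that]]) (simp add: h(3))
  define \<theta> where "\<theta> = ?ext (\<lambda>y. h y * 1)"
  define u where "u b = ?ext (\<lambda>y. h y * ((y + - c p) \<bullet> b))" for b
  define pd where "pd f q b = frechet_derivative (f \<circ> inv_into U c) (at (c q)) b"
    for f :: "'a \<Rightarrow> real" and q b
  define E where "E b f = (if f \<in> \<F> then ?ext (\<lambda>y. h y * frechet_derivative (f \<circ> inv_into U c) (at y) b) else 0)"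
    for b f
  have \<theta>: "\<theta> \<in> \<F>"
    unfolding \<theta>_def by (rule ext) (simp add: Cinf_on_def Ck_on_const B(1))
  have u: "u b \<in> \<F>" for b
    unfolding u_def
  proof (rule ext, unfold Cinf_on_def, rule allI)
    show "Ck_on k B (\<lambda>y. (y + - c p) \<bullet> b)" for k
      by (intro Ck_on_bounded_linear_comp[OF bounded_linear_inner_left] Ck_on_add Ck_on_const
          Ck_on_bounded_linear bounded_linear_ident B(1))
  qed
  have D: "((f \<circ> inv_into U c) has_derivative pd f q) (at (c q))" if "f \<in> \<F>" "q \<in> U" for f q
    unfolding pd_def
    by (rule Cinf_on_has_derivative[OF smooth_functions_chart[OF that(1) Uc] open_chart(2)[OF Uc]])
      (use that in auto)
  have pd_eq: "pd f q = L" if "((f \<circ> inv_into U c) has_derivative L) (at (c q))" for f q L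
    unfolding pd_def using frechet_derivative_at[OF that] by (simp add: fun_eq_iff)
  have E_apply: "E b f q = (if q \<in> U \<and> c q \<in> B then h (c q) * pd f q b else 0)" if "f \<in> \<F>" for b f q
    using that by (simp add: E_def extend_zero_def pd_def)
  have E: "E b \<in> \<X>" for b
  proof (rule vector_fieldsI)
    fix f assume f: "f \<in> \<F>"
    show "E b f \<in> \<F>"
      unfolding E_def if_P[OF f]
      by (rule ext, rule Cinf_on_subset[OF _ open_chart(2)[OF Uc] B(3)],
          rule Cinf_on_directional_derivative, rule smooth_functions_chart[OF f Uc])
    show "E b (\<lambda>p. k * f p) = (\<lambda>p. k * E b f p)" for k
    proof
      fix q
      have "pd (\<lambda>p. k * f p) q = (\<lambda>v. k * pd f q v)" if "q \<in> U"
        using has_derivative_mult_right[OF D[OF f that], of k] by (intro pd_eq) (simp add: comp_def)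
      then show "E b (\<lambda>p. k * f p) q = k * E b f q" using f by (simp add: E_apply)
    qed
    fix g assume g: "g \<in> \<F>"
    show "E b (f + g) = E b f + E b g"
    proof
      fix q
      have "pd (f + g) q = (\<lambda>v. pd f q v + pd g q v)" if "q \<in> U"
        using has_derivative_add[OF D[OF f that] D[OF g that]] by (intro pd_eq) (simp add: comp_def)
      then show "E b (f + g) q = (E b f + E b g) q" using f g by (simp add: E_apply algebra_simps)
    qed
    show "E b (f * g) = E b f * g + f * E b g"
    proof
      fix q
      have "pd (f * g) q = (\<lambda>v. f q * pd g q v + pd f q v * g q)" if "q \<in> U"
        using has_derivative_mult[OF D[OF f that] D[OF g that]] that Uc by (intro pd_eq) (simp add: comp_def)
      then show "E b (f * g) q = (E b f * g + f * E b g) q" using f g by (simp add: E_apply algebra_simps)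
    qed
  next
    fix f assume "f \<notin> \<F>"
    then show "E b f = 0" by (simp add: E_def)
  qed
  have \<theta>p: "\<theta> p = 1" using pU B(4) h(2) by (simp add: \<theta>_def extend_zero_def)
  have up: "u b p = 0" for b by (simp add: u_def extend_zero_def)
  have E_u: "E b (u b') p = (if b = b' then 1 else 0)" if "b \<in> Basis" "b' \<in> Basis" for b b'
  proof -
    have "((\<lambda>y. (y + - c p) \<bullet> b') has_derivative (\<lambda>v. v \<bullet> b')) (at (c p))"
      by (auto intro!: derivative_eq_intros)
    from has_derivative_mult[OF Cinf_on_has_derivative[OF hB B(1,4)] this]
    have "((\<lambda>y. h y * ((y + - c p) \<bullet> b')) has_derivative (\<lambda>v. v \<bullet> b')) (at (c p))"
      by (simp add: h(2))
    then have "((u b' \<circ> inv_into U c) has_derivative (\<lambda>v. v \<bullet> b')) (at (c p))"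
    proof (rule has_derivative_transform_within_open[OF _ B(1,4)])
      fix y assume "y \<in> B"
      then obtain q where "q \<in> U" "y = c q" using B(3) by blast
      then show "h y * ((y + - c p) \<bullet> b') = (u b' \<circ> inv_into U c) y"
        using \<open>y \<in> B\<close> Uc by (simp add: u_def extend_zero_def)
    qed
    then have "pd (u b') p = (\<lambda>v. v \<bullet> b')" by (rule pd_eq)
    then show ?thesis using pU B(4) h(2) that by (simp add: E_apply[OF u] inner_Basis)
  qed
  have key: "\<theta> q * \<theta> q * \<theta> q * X f q = (\<Sum>b\<in>Basis. (\<theta> q * X (u b) q - u b q * X \<theta> q) * E b f q)"
    if X: "X \<in> \<X>" and f: "f \<in> \<F>" for X f q
  proof (cases "q \<in> U \<and> c q \<in> B")
    case False
    then show ?thesis by (auto simp: \<theta>_def extend_zero_def E_apply[OF f])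
  next
    case True
    have "Cinf_on B (f \<circ> inv_into U c)"
      by (rule Cinf_on_subset[OF smooth_functions_chart[OF f Uc] open_chart(2)[OF Uc] B(3)])
    from Hadamard_lemma[OF B(1,2) conjunct2[OF True] this]
    obtain H where H: "\<And>b. Cinf_on B (H b)"
      "\<And>y. y \<in> B \<Longrightarrow> (f \<circ> inv_into U c) y = (f \<circ> inv_into U c) (c q) + (\<Sum>b\<in>Basis. ((y - c q) \<bullet> b) * H b y)"
      "\<And>b. H b (c q) = frechet_derivative (f \<circ> inv_into U c) (at (c q)) b" by blast
    define k where "k b = ?ext (\<lambda>y. h y * H b y)" for b
    have k: "k b \<in> \<F>" for b unfolding k_def by (rule ext[OF H(1)])
    define w where "w b = (c q - c p) \<bullet> b" for b
    have \<theta>q: "\<theta> q = h (c q)" using True by (simp add: \<theta>_def extend_zero_def)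
    have uq: "u b q = w b * \<theta> q" for b
      using True by (simp add: \<theta>_def u_def w_def extend_zero_def)
    have kq: "k b q = E b f q" for b
      using True by (simp add: E_apply[OF f] k_def extend_zero_def H(3) pd_def)
    \<comment> \<open>The first factor vanishes at \<open>q\<close>, so only its derivative survives in the product rule.\<close>
    have Xb: "X ((u b - (\<lambda>x. w b * \<theta> x)) * k b) q = (X (u b) q - w b * X \<theta> q) * E b f q" for b
    proof -
      have "X ((u b - (\<lambda>x. w b * \<theta> x)) * k b) =
          X (u b - (\<lambda>x. w b * \<theta> x)) * k b + (u b - (\<lambda>x. w b * \<theta> x)) * X (k b)"
        by (intro vf_mult X smooth_scale smooth_diff \<theta> u k)
      also have "X (u b - (\<lambda>x. w b * \<theta> x)) = X (u b) - (\<lambda>x. w b * X \<theta> x)"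
        unfolding vf_scale[OF X \<theta>, symmetric] by (intro vf_diff X smooth_scale \<theta> u)
      finally have e: "X ((u b - (\<lambda>x. w b * \<theta> x)) * k b) =
          (X (u b) - (\<lambda>x. w b * X \<theta> x)) * k b + (u b - (\<lambda>x. w b * \<theta> x)) * X (k b)" .
      show ?thesis unfolding e by (simp add: uq kq)
    qed
    \<comment> \<open>Hadamard's formula for \<open>f\<close> around \<open>q\<close>, multiplied by \<open>\<theta>\<^sup>2\<close> so that it holds globally.
      The numbers \<open>w b\<close> move the centre of the coordinates from \<open>p\<close> to \<open>q\<close>.\<close>
    have "\<theta> * \<theta> * f = (\<lambda>x. f q * (\<theta> * \<theta>) x) + (\<Sum>b\<in>Basis. (u b - (\<lambda>x. w b * \<theta> x)) * k b)"
    proof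
      fix x
      show "(\<theta> * \<theta> * f) x = ((\<lambda>x. f q * (\<theta> * \<theta>) x) + (\<Sum>b\<in>Basis. (u b - (\<lambda>x. w b * \<theta> x)) * k b)) x"
      proof (cases "x \<in> U \<and> c x \<in> B")
        case False
        then have "?ext F x = 0" for F by (auto simp: extend_zero_def)
        then show ?thesis by (simp add: \<theta>_def u_def k_def sum_fun_apply)
      next
        case in_B: True
        have "f x = f q + (\<Sum>b\<in>Basis. ((c x - c q) \<bullet> b) * H b (c x))"
          using H(2)[of "c x"] in_B True Uc by simp
        then have "(\<theta> * \<theta> * f) x = f q * (\<theta> x * \<theta> x) +
            h (c x) * h (c x) * (\<Sum>b\<in>Basis. ((c x - c q) \<bullet> b) * H b (c x))"
          using in_B by (simp add: \<theta>_def extend_zero_def distrib_left mult.commute mult.left_commute)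
        moreover have t: "(u b - (\<lambda>x. w b * \<theta> x)) x * k b x =
            h (c x) * h (c x) * (((c x - c q) \<bullet> b) * H b (c x))" for b
          using in_B by (simp add: \<theta>_def u_def k_def w_def extend_zero_def algebra_simps)
        have "(\<Sum>b\<in>Basis. (u b - (\<lambda>x. w b * \<theta> x)) * k b) x =
            h (c x) * h (c x) * (\<Sum>b\<in>Basis. ((c x - c q) \<bullet> b) * H b (c x))"
          by (simp only: sum_fun_apply times_fun_apply t sum_distrib_left)
        ultimately show ?thesis by simp
      qed
    qed
    then have "X (\<theta> * \<theta> * f) q =
        X ((\<lambda>x. f q * (\<theta> * \<theta>) x) + (\<Sum>b\<in>Basis. (u b - (\<lambda>x. w b * \<theta> x)) * k b)) q" by simp
    also have "X ((\<lambda>x. f q * (\<theta> * \<theta>) x) + (\<Sum>b\<in>Basis. (u b - (\<lambda>x. w b * \<theta> x)) * k b)) =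
        X (\<lambda>x. f q * (\<theta> * \<theta>) x) + X (\<Sum>b\<in>Basis. (u b - (\<lambda>x. w b * \<theta> x)) * k b)"
      by (intro vf_add X smooth_scale smooth_sum smooth_mult smooth_diff \<theta> u k)
    also have "X (\<lambda>x. f q * (\<theta> * \<theta>) x) = (\<lambda>x. f q * X (\<theta> * \<theta>) x)"
      by (intro vf_scale X smooth_mult \<theta>)
    also have "X (\<Sum>b\<in>Basis. (u b - (\<lambda>x. w b * \<theta> x)) * k b) =
        (\<Sum>b\<in>Basis. X ((u b - (\<lambda>x. w b * \<theta> x)) * k b))"
      by (intro vf_sum X smooth_scale smooth_mult smooth_diff \<theta> u k)
    also have "((\<lambda>x. f q * X (\<theta> * \<theta>) x) + (\<Sum>b\<in>Basis. X ((u b - (\<lambda>x. w b * \<theta> x)) * k b))) q =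
        f q * X (\<theta> * \<theta>) q + (\<Sum>b\<in>Basis. X ((u b - (\<lambda>x. w b * \<theta> x)) * k b) q)"
      by (simp add: sum_fun_apply)
    also have "\<dots> = f q * X (\<theta> * \<theta>) q + (\<Sum>b\<in>Basis. (X (u b) q - w b * X \<theta> q) * E b f q)"
      by (simp only: Xb)
    finally have "X (\<theta> * \<theta> * f) q =
        f q * X (\<theta> * \<theta>) q + (\<Sum>b\<in>Basis. (X (u b) q - w b * X \<theta> q) * E b f q)" .
    moreover have "X (\<theta> * \<theta> * f) q = f q * X (\<theta> * \<theta>) q + \<theta> q * \<theta> q * X f q"
      by (simp add: vf_mult[OF X smooth_mult[OF \<theta> \<theta>] f])
    ultimately have "\<theta> q * \<theta> q * X f q = (\<Sum>b\<in>Basis. (X (u b) q - w b * X \<theta> q) * E b f q)"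
      by simp
    then have "\<theta> q * \<theta> q * \<theta> q * X f q = \<theta> q * (\<Sum>b\<in>Basis. (X (u b) q - w b * X \<theta> q) * E b f q)" by simp
    also have "\<dots> = (\<Sum>b\<in>Basis. (\<theta> q * X (u b) q - u b q * X \<theta> q) * E b f q)"
      by (simp add: sum_distrib_left uq algebra_simps)
    finally show ?thesis .
  qed
  have frame: "\<omega> X p = (\<Sum>b\<in>Basis. X (u b) p * \<omega> (E b) p)" if \<omega>: "one_form M \<omega>" and X: "X \<in> \<X>" for \<omega> X
  proof -
    have s: "\<theta> * X (u b) - u b * X \<theta> \<in> \<F>" for b
      by (intro smooth_diff smooth_mult vf_smooth[OF X] u \<theta>)
    have "(\<theta> * \<theta> * \<theta>) \<odot> X = (\<Sum>b\<in>Basis. (\<theta> * X (u b) - u b * X \<theta>) \<odot> E b)"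
    proof (rule vf_eqI)
      show "((\<theta> * \<theta> * \<theta>) \<odot> X) f q = (\<Sum>b\<in>Basis. (\<theta> * X (u b) - u b * X \<theta>) \<odot> E b) f q" if "f \<in> \<F>" for f q
        using key[OF X that] by (simp add: sum_fun_apply)
    qed (use s E X \<theta> in \<open>auto intro!: fscale_vf sum_vf smooth_mult\<close>)
    then have "\<omega> ((\<theta> * \<theta> * \<theta>) \<odot> X) = \<omega> (\<Sum>b\<in>Basis. (\<theta> * X (u b) - u b * X \<theta>) \<odot> E b)" by simp
    also have "\<dots> = (\<Sum>b\<in>Basis. \<omega> ((\<theta> * X (u b) - u b * X \<theta>) \<odot> E b))"
      by (intro one_form_sum \<omega> fscale_vf s E)
    also have "\<dots> = (\<Sum>b\<in>Basis. (\<theta> * X (u b) - u b * X \<theta>) * \<omega> (E b))"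
      by (intro sum.cong one_form_fscale \<omega> s E refl)
    finally have "((\<theta> * \<theta> * \<theta>) * \<omega> X) p = (\<Sum>b\<in>Basis. (\<theta> * X (u b) - u b * X \<theta>) * \<omega> (E b)) p"
      using one_form_fscale[OF \<omega> _ X] \<theta> by simp
    then show ?thesis by (simp add: sum_fun_apply \<theta>p up)
  qed
  have "tangent_frame_axioms M p u E"
  proof (rule tangent_frame_axioms.intro)
    show "\<omega> X p = (\<Sum>b\<in>Basis. X (u b) p * \<omega> (E b) p)" if "one_form M \<omega>" "X \<in> \<X>" for \<omega> X
      by (rule frame[OF that])
    show "E b (u b') p = (if b = b' then 1 else 0)" if "b \<in> Basis" "b' \<in> Basis" for b b'
      by (rule E_u[OF that])
  qed (rule u E)+
  then have "tangent_frame M p u E" by (rule tangent_frame.intro[OF manifold_axioms])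
  then show ?thesis by (rule that)
qed

end

definition indexed_basis :: "(nat \<Rightarrow> 'e::euclidean_space) \<Rightarrow> bool" where
  "indexed_basis e \<longleftrightarrow>
     (\<forall>k. (\<Sum>i<DIM('e). k i *\<^sub>R e i) = 0 \<longrightarrow> (\<forall>i<DIM('e). k i = 0)) \<and>
     (\<forall>v. \<exists>k. v = (\<Sum>i<DIM('e). k i *\<^sub>R e i))"

lemma indexed_basis_exists: "\<exists>e :: nat \<Rightarrow> 'e::euclidean_space. indexed_basis e"
proof -
  obtain e :: "nat \<Rightarrow> 'e" where "bij_betw e {0..<card (Basis::'e set)} Basis"
    using ex_bij_betw_nat_finite[OF finite_Basis] by blast
  then have e: "bij_betw e {..<DIM('e)} Basis" by (simp add: atLeast0LessThan)
  have s: "(\<Sum>i<DIM('e). k i *\<^sub>R e i) = (\<Sum>b\<in>Basis. k (inv_into {..<DIM('e)} e b) *\<^sub>R b)" for k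
    using sum.reindex_bij_betw[OF e, of "\<lambda>b. k (inv_into {..<DIM('e)} e b) *\<^sub>R b"] e
    by (simp add: bij_betw_inv_into_left)
  have "indexed_basis e"
    unfolding indexed_basis_def
  proof (intro conjI allI impI)
    fix k i assume "(\<Sum>i<DIM('e). k i *\<^sub>R e i) = 0" and i: "i < DIM('e)"
    then have 0: "(\<Sum>b\<in>Basis. k (inv_into {..<DIM('e)} e b) *\<^sub>R b) = 0" using s by simp
    have ei: "e i \<in> Basis" using e i by (auto simp: bij_betw_def)
    have "k (inv_into {..<DIM('e)} e (e i)) = (\<Sum>b\<in>Basis. k (inv_into {..<DIM('e)} e b) *\<^sub>R b) \<bullet> e i"
      using ei by simp
    then show "k i = 0" using 0 e i by (simp add: bij_betw_inv_into_left)
  next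
    fix v :: 'e
    have "v = (\<Sum>i<DIM('e). (v \<bullet> e i) *\<^sub>R e i)"
      using sum.reindex_bij_betw[OF e, of "\<lambda>b. (v \<bullet> b) *\<^sub>R b"] by (simp add: euclidean_representation)
    then show "\<exists>k. v = (\<Sum>i<DIM('e). k i *\<^sub>R e i)" by (rule exI[of _ "\<lambda>i. v \<bullet> e i"])
  qed
  then show ?thesis by blast
qed

text \<open>
The trace computed in any basis equals the trace in the standard orthonormal basis. If \<open>P b i\<close> are the
coordinates of the standard basis vectors in the basis \<open>e\<close>, then \<open>P\<close> is inverse to the matrix of the
inner products of \<open>e j\<close> and \<open>b\<close>.
\<close>

lemma trace_indexed_basis:
  fixes \<tau> :: "'e::euclidean_space \<Rightarrow> 'e"
  assumes "linear \<tau>" "indexed_basis e"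
    and A: "\<And>i. i < DIM('e) \<Longrightarrow> \<tau> (e i) = (\<Sum>j<DIM('e). A i j *\<^sub>R e j)"
  shows "(\<Sum>i<DIM('e). A i i) = (\<Sum>b\<in>Basis. \<tau> b \<bullet> b)"
proof -
  let ?n = "DIM('e)"
  obtain P where P: "\<And>v. v = (\<Sum>i<?n. P v i *\<^sub>R e i)"
    using assms(2) unfolding indexed_basis_def by metis
  \<comment> \<open>\<open>P\<close> is inverse to the matrix of the inner products.\<close>
  have dual: "(\<Sum>b\<in>Basis. (e j \<bullet> b) * P b i) = (if i = j then 1 else 0)" if "i < ?n" "j < ?n" for i j
  proof -
    have "e j = (\<Sum>b\<in>Basis. (e j \<bullet> b) *\<^sub>R b)" by (simp add: euclidean_representation)
    also have "\<dots> = (\<Sum>b\<in>Basis. (e j \<bullet> b) *\<^sub>R (\<Sum>i<?n. P b i *\<^sub>R e i))" using P by simp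
    also have "\<dots> = (\<Sum>b\<in>Basis. \<Sum>i<?n. ((e j \<bullet> b) * P b i) *\<^sub>R e i)"
      by (simp add: scaleR_sum_right)
    also have "\<dots> = (\<Sum>i<?n. \<Sum>b\<in>Basis. ((e j \<bullet> b) * P b i) *\<^sub>R e i)" by (rule sum.swap)
    also have "\<dots> = (\<Sum>i<?n. (\<Sum>b\<in>Basis. (e j \<bullet> b) * P b i) *\<^sub>R e i)"
      by (simp add: scaleR_sum_left)
    finally have a: "e j = (\<Sum>i<?n. (\<Sum>b\<in>Basis. (e j \<bullet> b) * P b i) *\<^sub>R e i)" .
    have b: "e j = (\<Sum>i<?n. (if i = j then 1 else 0) *\<^sub>R e i)"
      using that by (simp add: if_distrib[of "\<lambda>c. c *\<^sub>R _"] sum.delta cong: if_cong)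
    have "(\<Sum>i<?n. ((\<Sum>b\<in>Basis. (e j \<bullet> b) * P b i) - (if i = j then 1 else 0)) *\<^sub>R e i) = 0"
      unfolding scaleR_left_diff_distrib sum_subtractf using a b by simp
    then show ?thesis using assms(2) that unfolding indexed_basis_def by fastforce
  qed
  have \<tau>: "\<tau> b = (\<Sum>i<?n. \<Sum>j<?n. (P b i * A i j) *\<^sub>R e j)" for b
  proof -
    have "\<tau> b = \<tau> (\<Sum>i<?n. P b i *\<^sub>R e i)" using P by simp
    also have "\<dots> = (\<Sum>i<?n. P b i *\<^sub>R \<tau> (e i))"
      by (simp add: linear_sum[OF assms(1)] linear_scale[OF assms(1)])
    also have "\<dots> = (\<Sum>i<?n. \<Sum>j<?n. (P b i * A i j) *\<^sub>R e j)"
      by (simp add: A scaleR_sum_right)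
    finally show ?thesis .
  qed
  have "(\<Sum>b\<in>Basis. \<tau> b \<bullet> b) = (\<Sum>b\<in>Basis. \<Sum>i<?n. \<Sum>j<?n. A i j * ((e j \<bullet> b) * P b i))"
    by (simp add: \<tau> inner_sum_left algebra_simps)
  also have "\<dots> = (\<Sum>i<?n. \<Sum>b\<in>Basis. \<Sum>j<?n. A i j * ((e j \<bullet> b) * P b i))" by (rule sum.swap)
  also have "\<dots> = (\<Sum>i<?n. \<Sum>j<?n. \<Sum>b\<in>Basis. A i j * ((e j \<bullet> b) * P b i))"
    by (intro sum.cong refl sum.swap)
  also have "\<dots> = (\<Sum>i<?n. \<Sum>j<?n. A i j * (if i = j then 1 else 0))"
    by (intro sum.cong refl) (simp add: sum_distrib_left[symmetric] dual)
  also have "\<dots> = (\<Sum>i<?n. A i i)" by (simp add: if_distrib sum.delta cong: if_cong)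
  finally show ?thesis by simp
qed

context tangent_frame
begin

definition coord :: "'a vfield \<Rightarrow> 'e" where
  "coord X = (\<Sum>b\<in>Basis. X (u b) p *\<^sub>R b)"

definition lift :: "'e \<Rightarrow> 'a vfield" where
  "lift v = (\<Sum>b\<in>Basis. (\<lambda>_. v \<bullet> b) \<odot> E b)"

lemma coord_inner: "b \<in> Basis \<Longrightarrow> coord X \<bullet> b = X (u b) p"
  by (simp add: coord_def)

lemma coord_add: "coord (X + Y) = coord X + coord Y"
  by (simp add: coord_def scaleR_add_left sum.distrib)

lemma coord_fscale: "coord (f \<odot> X) = f p *\<^sub>R coord X"
  by (simp add: coord_def scaleR_sum_right)

lemma coord_diff: "coord (X - Y) = coord X - coord Y"
  by (simp add: coord_def scaleR_diff_left sum_subtractf)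

lemma coord_minus: "coord (- X) = - coord X"
  by (simp add: coord_def sum_negf)

lemma coord_zero: "coord 0 = 0"
  by (simp add: coord_def)

lemma lift_vf [simp]: "lift v \<in> \<X>"
  unfolding lift_def by (intro sum_vf fscale_vf smooth_const E_vf)

lemma coord_lift [simp]: "coord (lift v) = v"
proof (rule euclidean_eqI)
  fix b :: 'e assume b: "b \<in> Basis"
  have "coord (lift v) \<bullet> b = (\<Sum>b'\<in>Basis. (v \<bullet> b') * E b' (u b) p)"
    by (simp add: coord_inner[OF b] lift_def sum_fun_apply)
  also have "\<dots> = (\<Sum>b'\<in>Basis. if b' = b then v \<bullet> b' else 0)"
    by (intro sum.cong refl) (simp add: E_u b)
  also have "\<dots> = v \<bullet> b" using b by simp
  finally show "coord (lift v) \<bullet> b = v \<bullet> b" .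
qed

lemma one_form_coord:
  assumes "one_form M \<omega>" "X \<in> \<X>"
  shows "\<omega> X p = (\<Sum>b\<in>Basis. (coord X \<bullet> b) * \<omega> (E b) p)"
  using one_form_frame[OF assms] by (simp add: coord_inner)

lemma one_form_lift:
  assumes "one_form M \<omega>" "X \<in> \<X>"
  shows "\<omega> X p = \<omega> (lift (coord X)) p"
  by (simp add: one_form_coord[OF assms] one_form_coord[OF assms(1) lift_vf])

lemma one_form_linear:
  assumes "one_form M \<omega>"
  shows "linear (\<lambda>v. \<omega> (lift v) p)"
  by (simp add: one_form_coord[OF assms lift_vf] linear_iff inner_add_left distrib_right
      sum.distrib sum_distrib_left mult.assoc)

lemma vf_lift:
  assumes "X \<in> \<X>"
  shows "X f p = lift (coord X) f p"
  using one_form_lift[OF one_form_evaluation assms, of f] assms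
  by (cases "f \<in> \<F>") (simp_all add: vf_nonsmooth)

lemma coord_eq_iff: "X \<in> \<X> \<Longrightarrow> Y \<in> \<X> \<Longrightarrow> coord X = coord Y \<longleftrightarrow> (\<forall>f. X f p = Y f p)"
proof
  assume X: "X \<in> \<X>" and Y: "Y \<in> \<X>" and "coord X = coord Y"
  then show "\<forall>f. X f p = Y f p" using vf_lift[OF X] vf_lift[OF Y] by simp
qed (simp add: coord_def)

lemma tensor11_lift:
  assumes "tensor11 M T" "X \<in> \<X>"
  shows "coord (T X) = coord (T (lift (coord X)))"
  by (rule euclidean_eqI)
    (use one_form_lift[OF one_form_tensor11[OF assms(1) u_smooth] assms(2)] in \<open>simp add: coord_inner\<close>)

lemma tensor11_linear:
  assumes "tensor11 M T"
  shows "linear (\<lambda>v. coord (T (lift v)))"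
proof -
  have "linear (\<lambda>v. T (lift v) (u b) p)" for b
    by (rule one_form_linear[OF one_form_tensor11[OF assms u_smooth]])
  then show ?thesis
    by (auto simp: linear_iff euclidean_eq_iff[where 'a='e] coord_inner inner_add_left)
qed

text \<open>
Linear relations between tangent vectors at \<open>p\<close>, stated for functionals on functions, become linear
relations between coordinate vectors.
\<close>

lemma coord_combination_iff:
  assumes "X \<in> \<X>" "\<And>i. i \<in> I \<Longrightarrow> Y i \<in> \<X>"
  shows "(\<forall>f. X f p = (\<Sum>i\<in>I. k i * Y i f p)) \<longleftrightarrow> coord X = (\<Sum>i\<in>I. k i *\<^sub>R coord (Y i))"
proof -
  have Z: "(\<Sum>i\<in>I. (\<lambda>_. k i) \<odot> Y i) \<in> \<X>" using assms(2) by (intro sum_vf fscale_vf smooth_const)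
  have c: "coord (\<Sum>i\<in>I. (\<lambda>_. k i) \<odot> Y i) = (\<Sum>i\<in>I. k i *\<^sub>R coord (Y i))"
    by (rule euclidean_eqI) (simp add: coord_inner inner_sum_left sum_fun_apply)
  show ?thesis unfolding c[symmetric] coord_eq_iff[OF assms(1) Z] by (simp add: sum_fun_apply)
qed

lemma basis_at_iff:
  "basis_at M p F \<longleftrightarrow> (\<forall>i<DIM('e). F i \<in> \<X>) \<and> indexed_basis (\<lambda>i. coord (F i))"
proof (cases "\<forall>i<DIM('e). F i \<in> \<X>")
  case True
  have 1: "(\<forall>f. (\<Sum>i<DIM('e). k i * F i f p) = 0) \<longleftrightarrow> (\<Sum>i<DIM('e). k i *\<^sub>R coord (F i)) = 0" for k
    using coord_combination_iff[of 0 "{..<DIM('e)}" F k] True by (simp add: coord_zero eq_commute[of 0])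
  have 2: "(\<forall>f. X f p = (\<Sum>i<DIM('e). k i * F i f p)) \<longleftrightarrow> coord X = (\<Sum>i<DIM('e). k i *\<^sub>R coord (F i))"
    if "X \<in> \<X>" for X k
    using coord_combination_iff[OF that, of "{..<DIM('e)}" F k] True by simp
  have 3: "(\<forall>X\<in>\<X>. \<exists>k. \<forall>f. X f p = (\<Sum>i<DIM('e). k i * F i f p)) \<longleftrightarrow>
      (\<forall>v. \<exists>k. v = (\<Sum>i<DIM('e). k i *\<^sub>R coord (F i)))"
  proof (intro iffI ballI allI)
    fix v assume "\<forall>X\<in>\<X>. \<exists>k. \<forall>f. X f p = (\<Sum>i<DIM('e). k i * F i f p)"
    from bspec[OF this lift_vf[of v]] obtain k where "\<forall>f. lift v f p = (\<Sum>i<DIM('e). k i * F i f p)" ..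
    then show "\<exists>k. v = (\<Sum>i<DIM('e). k i *\<^sub>R coord (F i))"
      unfolding 2[OF lift_vf] coord_lift by blast
  next
    fix X assume "\<forall>v. \<exists>k. v = (\<Sum>i<DIM('e). k i *\<^sub>R coord (F i))" and X: "X \<in> \<X>"
    then obtain k where "coord X = (\<Sum>i<DIM('e). k i *\<^sub>R coord (F i))" by blast
    then show "\<exists>k. \<forall>f. X f p = (\<Sum>i<DIM('e). k i * F i f p)"
      unfolding 2[OF X, symmetric] by blast
  qed
  show ?thesis unfolding basis_at_def indexed_basis_def 1 3 using True by blast
next
  case False
  then show ?thesis unfolding basis_at_def by blast
qed

text \<open>
All the bases at \<open>p\<close> give the same trace, and there is at least one, so the definite description in the
definition of the trace is meaningful.
\<close>

lemma trace_at_eq: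
  assumes T: "tensor11 M T"
  shows "trace_at M T p = (\<Sum>b\<in>Basis. coord (T (lift b)) \<bullet> b)"
proof -
  let ?n = "DIM('e)"
  have TX: "T X \<in> \<X>" if "X \<in> \<X>" for X by (rule tensor11_vf[OF T that])
  have tr: "(\<Sum>i<?n. A i i) = (\<Sum>b\<in>Basis. coord (T (lift b)) \<bullet> b)"
    if "basis_at M p F" "\<forall>i<?n. \<forall>f. T (F i) f p = (\<Sum>j<?n. A i j * F j f p)" for F A
  proof (rule trace_indexed_basis[where A=A and e="\<lambda>i. coord (F i)", OF tensor11_linear[OF T]])
    have F: "\<And>i. i < ?n \<Longrightarrow> F i \<in> \<X>" using that(1) basis_at_iff by blast
    show "indexed_basis (\<lambda>i. coord (F i))" using that(1) basis_at_iff by blast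
    fix i assume i: "i < ?n"
    have "coord (T (F i)) = (\<Sum>j<?n. A i j *\<^sub>R coord (F j))"
      using coord_combination_iff[OF TX[OF F[OF i]], of "{..<?n}" F "A i"] F that(2) i by simp
    then show "coord (T (lift (coord (F i)))) = (\<Sum>j<?n. A i j *\<^sub>R coord (F j))"
      using tensor11_lift[OF T F[OF i]] by simp
  qed
  obtain e :: "nat \<Rightarrow> 'e" where e: "indexed_basis e" using indexed_basis_exists by blast
  define F where "F i = lift (e i)" for i
  have F: "basis_at M p F" using e by (simp add: basis_at_iff F_def)
  obtain A where A: "\<And>v. v = (\<Sum>j<?n. A v j *\<^sub>R e j)"
    using e unfolding indexed_basis_def by metis
  have A': "\<forall>i<?n. \<forall>f. T (F i) f p = (\<Sum>j<?n. A (coord (T (F i))) j * F j f p)"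
  proof (intro allI impI)
    fix i f assume "i < ?n"
    have "coord (T (F i)) = (\<Sum>j<?n. A (coord (T (F i))) j *\<^sub>R coord (F j))"
      using A[of "coord (T (F i))"] by (simp add: F_def)
    then show "T (F i) f p = (\<Sum>j<?n. A (coord (T (F i))) j * F j f p)"
      using coord_combination_iff[OF TX[of "F i"], of "{..<?n}" F "A (coord (T (F i)))"]
      by (simp add: F_def)
  qed
  show ?thesis
    unfolding trace_at_def
  proof (rule the_equality)
    show "\<exists>F A. basis_at M p F \<and> (\<forall>i<?n. \<forall>f. T (F i) f p = (\<Sum>j<?n. A i j * F j f p)) \<and>
        (\<Sum>b\<in>Basis. coord (T (lift b)) \<bullet> b) = (\<Sum>i<?n. A i i)"
      using F A' tr[OF F A'] by (intro exI[of _ F] exI[of _ "\<lambda>i. A (coord (T (F i)))"]) simp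
  qed (use tr in blast)
qed

end

section \<open>Curvature tensors on a three-dimensional vector space\<close>

locale nondegenerate_form =
  fixes g :: "'v::euclidean_space \<Rightarrow> 'v \<Rightarrow> real"
  assumes linear_g: "\<And>x. linear (g x)"
    and g_sym: "\<And>x y. g x y = g y x"
    and g_nondegenerate: "\<And>x. (\<And>y. g x y = 0) \<Longrightarrow> x = 0"
begin

lemma g_add_right: "g x (y + z) = g x y + g x z"
  and g_diff_right: "g x (y - z) = g x y - g x z"
  and g_scale_right: "g x (c *\<^sub>R y) = c * g x y"
  and g_zero_right: "g x 0 = 0"
  and g_minus_right: "g x (- y) = - g x y"
  using linear_g[of x] by (simp_all add: linear_add linear_diff linear_scale linear_0 linear_neg)

lemma g_add_left: "g (x + y) z = g x z + g y z"
  and g_diff_left: "g (x - y) z = g x z - g y z"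
  and g_scale_left: "g (c *\<^sub>R x) z = c * g x z"
  and g_zero_left: "g 0 z = 0"
  and g_minus_left: "g (- x) z = - g x z"
  using g_sym[of _ z] by (simp_all add: g_add_right g_diff_right g_scale_right g_zero_right g_minus_right)

lemmas g_simps = g_add_right g_diff_right g_scale_right g_zero_right g_minus_right
  g_add_left g_diff_left g_scale_left g_zero_left g_minus_left

lemma orthogonal_span:
  assumes "\<And>s. s \<in> S \<Longrightarrow> g v s = 0" "x \<in> span S"
  shows "g v x = 0"
  using linear_eq_0_on_span[OF linear_g assms] .

text \<open>
One step of the Gram-Schmidt process for an indefinite form. Projection of a vector outside the span gives
\<open>v \<noteq> 0\<close> orthogonal to \<open>S\<close>; nondegeneracy gives a partner \<open>w'\<close>, also orthogonal to \<open>S\<close>, that is not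
orthogonal to \<open>v\<close>. If both are null, their sum is not.
\<close>

lemma nonnull_orthogonal_vector_exists:
  assumes "finite S" "card S < DIM('v)"
    and proj: "\<And>x. \<pi> x \<in> span S" "\<And>x s. s \<in> S \<Longrightarrow> g (x - \<pi> x) s = 0"
  obtains v where "g v v \<noteq> 0" "\<And>s. s \<in> S \<Longrightarrow> g v s = 0"
proof -
  have "span S \<noteq> UNIV"
  proof
    assume "span S = UNIV"
    then have "DIM('v) \<le> card S" using dim_le_card'[OF assms(1)] by (metis dim_UNIV dim_span)
    then show False using assms(2) by simp
  qed
  then obtain x where "x \<notin> span S" by blast
  define v where "v = x - \<pi> x"
  have "v \<noteq> 0" using \<open>x \<notin> span S\<close> proj(1)[of x] by (auto simp: v_def)
  then obtain w where w: "g v w \<noteq> 0" using g_nondegenerate by blast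
  define w' where "w' = w - \<pi> w"
  have v: "g v s = 0" if "s \<in> S" for s using proj(2)[OF that] by (simp add: v_def)
  have w': "g w' s = 0" if "s \<in> S" for s using proj(2)[OF that] by (simp add: w'_def)
  have vw': "g v w' \<noteq> 0"
    using w orthogonal_span[OF v proj(1)] by (simp add: w'_def g_simps)
  show ?thesis
  proof (cases "g v v = 0 \<and> g w' w' = 0")
    case True
    then have "g (v + w') (v + w') = 2 * g v w'" using g_sym[of w' v] by (simp add: g_simps)
    then show ?thesis using that[of "v + w'"] vw' v w' by (simp add: g_simps)
  next
    case False
    then show ?thesis using that v w' by blast
  qed
qed

lemma orthogonal_frame_exists:
  assumes "DIM('v) = 3" "g z z \<noteq> 0"
  obtains e1 e2 where "g z e1 = 0" "g z e2 = 0" "g e1 e2 = 0" "g e1 e1 \<noteq> 0" "g e2 e2 \<noteq> 0"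
proof -
  obtain e1 where "g e1 e1 \<noteq> 0" "\<And>s. s \<in> {z} \<Longrightarrow> g e1 s = 0"
  proof (rule nonnull_orthogonal_vector_exists[of "{z}" "\<lambda>x. (g x z / g z z) *\<^sub>R z"])
    show "(g x z / g z z) *\<^sub>R z \<in> span {z}" for x by (simp add: span_base span_scale)
  qed (use assms in \<open>auto simp: g_simps\<close>)
  then have e1: "g e1 e1 \<noteq> 0" "g e1 z = 0" by auto
  obtain e2 where "g e2 e2 \<noteq> 0" "\<And>s. s \<in> {z, e1} \<Longrightarrow> g e2 s = 0"
  proof (rule nonnull_orthogonal_vector_exists[of "{z, e1}"
        "\<lambda>x. (g x z / g z z) *\<^sub>R z + (g x e1 / g e1 e1) *\<^sub>R e1"])
    show "(g x z / g z z) *\<^sub>R z + (g x e1 / g e1 e1) *\<^sub>R e1 \<in> span {z, e1}" for x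
      by (intro span_add span_scale span_base) auto
    show "card {z, e1} < DIM('v)" using assms(1) card_insert_le_m1[of 2 "{e1}" z] by simp
  qed (use assms e1 g_sym[of z e1] in \<open>auto simp: g_simps\<close>)
  then show ?thesis using that[of e1 e2] e1 g_sym[of z e1] g_sym[of z e2] g_sym[of e1 e2] by auto
qed

end

locale orthogonal_frame3 = nondegenerate_form g for g :: "'v::euclidean_space \<Rightarrow> 'v \<Rightarrow> real" +
  fixes e0 e1 e2 :: 'v
  assumes DIM3: "DIM('v) = 3"
    and orth: "g e0 e1 = 0" "g e0 e2 = 0" "g e1 e2 = 0"
    and nonnull: "g e0 e0 \<noteq> 0" "g e1 e1 \<noteq> 0" "g e2 e2 \<noteq> 0"
begin

lemma orth': "g e1 e0 = 0" "g e2 e0 = 0" "g e2 e1 = 0"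
  using orth g_sym by metis+

lemmas frame_simps = orth orth' nonnull

lemma span_frame: "span {e0, e1, e2} = UNIV"
proof -
  have e1: "e1 \<notin> span {e0}"
    using orthogonal_span[of "{e0}" e1 e1] frame_simps by auto
  have e2: "e2 \<notin> span {e1, e0}"
    using orthogonal_span[of "{e1, e0}" e2 e2] frame_simps by auto
  have "e0 \<noteq> 0" using nonnull(1) by (auto simp: g_simps)
  then have "independent {e2, e1, e0}"
    using e1 e2 by (auto simp: independent_insert)
  moreover have "card {e2, e1, e0} = 3"
    using e1 e2 by (metis card_3_iff insertCI span_base)
  ultimately have "UNIV \<subseteq> span {e2, e1, e0}"
    using DIM3 by (intro card_ge_dim_independent) auto
  then show ?thesis by (metis insert_commute top.extremum_uniqueI)
qed

text \<open>
Identities between multilinear expressions need to be verified only on \<open>e0, e1, e2\<close>.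
\<close>

lemma linear_eq_on_frame:
  assumes "linear F" "linear G" "F e0 = G e0" "F e1 = G e1" "F e2 = G e2"
  shows "F x = G x"
  by (rule linear_eq_on_span[OF assms(1,2), of "{e0, e1, e2}"]) (use assms span_frame in auto)

lemma frame_expansion:
  "x = (g x e0 / g e0 e0) *\<^sub>R e0 + (g x e1 / g e1 e1) *\<^sub>R e1 + (g x e2 / g e2 e2) *\<^sub>R e2"
  by (rule linear_eq_on_frame[of "\<lambda>x. x"])
    (simp_all add: linear_iff g_simps frame_simps add_divide_distrib algebra_simps)

lemma g_eqI:
  assumes "\<And>w. g x w = g y w"
  shows "x = y"
  using g_nondegenerate[of "x - y"] assms by (simp add: g_simps)

lemma trace_frame:
  assumes "linear \<tau>"
  shows "(\<Sum>b\<in>Basis. \<tau> b \<bullet> b) =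
    g (\<tau> e0) e0 / g e0 e0 + g (\<tau> e1) e1 / g e1 e1 + g (\<tau> e2) e2 / g e2 e2"
proof -
  define e where "e i = (if i = 0 then e0 else if i = 1 then e1 else e2)" for i :: nat
  have S: "(\<Sum>i<DIM('v). f i) = f 0 + f 1 + f 2" for f :: "nat \<Rightarrow> 'v"
    unfolding DIM3 by (simp add: numeral_3_eq_3 numeral_2_eq_2)
  have S': "(\<Sum>i<DIM('v). f i) = f 0 + f 1 + f 2" for f :: "nat \<Rightarrow> real"
    unfolding DIM3 by (simp add: numeral_3_eq_3 numeral_2_eq_2)
  have I: "(\<forall>i<DIM('v). P i) \<longleftrightarrow> P 0 \<and> P 1 \<and> P 2" for P :: "nat \<Rightarrow> bool"
    unfolding DIM3 numeral_3_eq_3 numeral_2_eq_2 by (auto simp: less_Suc_eq)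
  have vb: "indexed_basis e"
    unfolding indexed_basis_def S I
  proof (intro conjI allI impI)
    fix k :: "nat \<Rightarrow> real" assume "k 0 *\<^sub>R e 0 + k 1 *\<^sub>R e 1 + k 2 *\<^sub>R e 2 = 0"
    then have z: "k 0 *\<^sub>R e0 + k 1 *\<^sub>R e1 + k 2 *\<^sub>R e2 = 0" by (simp add: e_def)
    show "k 0 = 0" using arg_cong[OF z, of "g e0"] by (simp add: g_simps frame_simps)
    show "k 1 = 0" using arg_cong[OF z, of "g e1"] by (simp add: g_simps frame_simps)
    show "k 2 = 0" using arg_cong[OF z, of "g e2"] by (simp add: g_simps frame_simps)
  next
    fix v
    show "\<exists>k::nat \<Rightarrow> real. v = k 0 *\<^sub>R e 0 + k 1 *\<^sub>R e 1 + k 2 *\<^sub>R e 2"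
      using frame_expansion[of v] by (intro exI[of _ "\<lambda>i. g v (e i) / g (e i) (e i)"]) (simp add: e_def)
  qed
  define A where "A i j = g (\<tau> (e i)) (e j) / g (e j) (e j)" for i j
  have "\<tau> (e i) = (\<Sum>j<DIM('v). A i j *\<^sub>R e j)" for i
    unfolding S using frame_expansion[of "\<tau> (e i)"] by (simp add: A_def e_def)
  from trace_indexed_basis[OF assms vb this]
  show ?thesis unfolding S' by (simp add: A_def e_def)
qed

end

locale curvature_tensor = nondegenerate_form g for g :: "'v::euclidean_space \<Rightarrow> 'v \<Rightarrow> real" +
  fixes r :: "'v \<Rightarrow> 'v \<Rightarrow> 'v \<Rightarrow> 'v"
  assumes linear_r1: "\<And>y z. linear (\<lambda>x. r x y z)"
    and linear_r2: "\<And>x z. linear (\<lambda>y. r x y z)"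
    and linear_r3: "\<And>x y. linear (r x y)"
    and r_antisym: "\<And>x y z. r y x z = - r x y z"
    and r_skew: "\<And>x y z w. g (r x y w) z = - g (r x y z) w"
    and bianchi: "\<And>x y z. r x y z + r y z x + r z x y = 0"
begin

text \<open>
The classical octahedron argument: add the four Bianchi identities for the cyclic permutations of the
arguments and cancel with the two skew symmetries.
\<close>

lemma pair_symmetry: "g (r x y z) w = g (r z w x) y"
proof -
  have b: "g (r x y z) w + g (r y z x) w + g (r z x y) w = 0" for x y z w
    using arg_cong[OF bianchi[of x y z], of "\<lambda>v. g v w"] by (simp add: g_simps)
  have a: "g (r y x z) w = - g (r x y z) w" for x y z w
    by (simp add: r_antisym[of y x] g_simps)
  show ?thesis
    using b[of x y z w] b[of y z w x] b[of z w x y] b[of w x y z]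
      a[of y x z w] a[of z x y w] a[of w y z x] a[of x z w y] a[of y w x z] a[of w z x y] a[of z w x y] a[of x w y z]
      a[of z y w x] a[of z y x w] a[of w x y z] a[of w x z y]
      r_skew[of x y z w] r_skew[of y z x w] r_skew[of z x y w] r_skew[of y w z x]
      r_skew[of z w x y] r_skew[of w x y z] r_skew[of w y z x] r_skew[of x z w y] r_skew[of x w y z]
    by linarith
qed

end

context nondegenerate_form
begin

text \<open>
The general curvature tensor that is invariant under the rotations about \<open>\<xi>\<close>. Planes orthogonal to \<open>\<xi>\<close>
have sectional curvature \<open>\<mu>\<close>, planes through \<open>\<xi>\<close> have \<open>\<mu> + \<nu> g(\<xi>, \<xi>)\<close>.
\<close>

definition model_curvature :: "'v \<Rightarrow> real \<Rightarrow> real \<Rightarrow> 'v \<Rightarrow> 'v \<Rightarrow> 'v \<Rightarrow> 'v" where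
  "model_curvature \<xi> \<mu> \<nu> x y z =
     \<mu> *\<^sub>R (g y z *\<^sub>R x - g x z *\<^sub>R y) +
     \<nu> *\<^sub>R ((g y z * g x \<xi> - g x z * g y \<xi>) *\<^sub>R \<xi> + (g y \<xi> * g z \<xi>) *\<^sub>R x - (g x \<xi> * g z \<xi>) *\<^sub>R y)"

text \<open>
A skew endomorphism that annihilates \<open>\<xi>\<close> acts as a derivation on everything built from \<open>g\<close> and \<open>\<xi>\<close>.
\<close>

lemma model_curvature_derivation:
  assumes "linear D" and skew: "\<And>v w. g (D v) w = - g v (D w)" and "D \<xi> = 0"
  shows "D (model_curvature \<xi> \<mu> \<nu> x y z) =
    model_curvature \<xi> \<mu> \<nu> (D x) y z + model_curvature \<xi> \<mu> \<nu> x (D y) z + model_curvature \<xi> \<mu> \<nu> x y (D z)"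
proof -
  have \<xi>: "g (D v) \<xi> = 0" for v using skew[of v \<xi>] assms(3) by (simp add: g_simps)
  have D: "D (a *\<^sub>R v) = a *\<^sub>R D v" "D (v + w) = D v + D w" "D (v - w) = D v - D w" for a v w
    using assms(1) by (simp_all add: linear_scale linear_add linear_diff)
  show ?thesis
    by (simp add: model_curvature_def D skew assms(3) \<xi> g_simps) (simp add: algebra_simps)
qed

lemma model_curvature_diff_scale:
  "model_curvature \<xi> \<mu> \<nu> (x - c *\<^sub>R x') y z = model_curvature \<xi> \<mu> \<nu> x y z - c *\<^sub>R model_curvature \<xi> \<mu> \<nu> x' y z"
  "model_curvature \<xi> \<mu> \<nu> x (y - c *\<^sub>R y') z = model_curvature \<xi> \<mu> \<nu> x y z - c *\<^sub>R model_curvature \<xi> \<mu> \<nu> x y' z"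
  "model_curvature \<xi> \<mu> \<nu> x y (z - c *\<^sub>R z') = model_curvature \<xi> \<mu> \<nu> x y z - c *\<^sub>R model_curvature \<xi> \<mu> \<nu> x y z'"
  by (simp_all add: model_curvature_def g_simps algebra_simps)

text \<open>
The difference \<open>D = r(x, y) - \<kappa> R(x, y)\<close> is a multiple of an infinitesimal rotation about \<open>\<xi>\<close>, because
both terms agree on the planes through \<open>\<xi>\<close>. So \<open>D\<close> acts trivially on \<open>r\<close>, and this is the claim
written out.
\<close>

lemma model_curvature_pseudo_symmetric:
  fixes \<xi> x y a b c :: 'v and \<mu> \<nu> :: real
  defines "\<kappa> \<equiv> \<mu> + \<nu> * g \<xi> \<xi>"
    and "r \<equiv> model_curvature \<xi> \<mu> \<nu>"
    and "R \<equiv> \<lambda>x y z. g y z *\<^sub>R x - g x z *\<^sub>R y"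
  shows "r x y (r a b c) - r (r x y a) b c - r a (r x y b) c - r a b (r x y c) =
    \<kappa> *\<^sub>R (R x y (r a b c) - r (R x y a) b c - r a (R x y b) c - r a b (R x y c))"
proof -
  define D where "D v = r x y v - \<kappa> *\<^sub>R R x y v" for v
  have D_eq: "D v = \<nu> *\<^sub>R ((g y v * g x \<xi> - g x v * g y \<xi>) *\<^sub>R \<xi> + (g y \<xi> * g v \<xi>) *\<^sub>R x - (g x \<xi> * g v \<xi>) *\<^sub>R y
      - (g \<xi> \<xi> * g y v) *\<^sub>R x + (g \<xi> \<xi> * g x v) *\<^sub>R y)" for v
    by (simp add: D_def r_def R_def \<kappa>_def model_curvature_def algebra_simps)
  have "D (r a b c) = r (D a) b c + r a (D b) c + r a b (D c)"
    unfolding r_def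
  proof (rule model_curvature_derivation)
    show "linear D"
      by (simp add: linear_iff D_eq g_simps algebra_simps)
    show "g (D v) w = - g v (D w)" for v w
      by (simp add: D_eq g_simps g_sym algebra_simps)
    show "D \<xi> = 0"
      by (simp add: D_eq g_sym algebra_simps)
  qed
  then show ?thesis
    unfolding D_def r_def model_curvature_diff_scale by (simp add: algebra_simps)
qed

end

text \<open>
Applied first to one pair of arguments of a tensor with the symmetries of a curvature tensor and then to the
other pair, this reduces its vanishing to nine components.
\<close>

lemma (in orthogonal_frame3) alternating_eq_0:
  fixes A :: "'v \<Rightarrow> 'v \<Rightarrow> real"
  assumes l1: "\<And>y. linear (\<lambda>x. A x y)" and l2: "\<And>x. linear (A x)"
    and anti: "\<And>x y. A y x = - A x y"
    and zero: "A e0 e1 = 0" "A e0 e2 = 0" "A e1 e2 = 0"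
  shows "A x y = 0"
proof -
  have d: "A x x = 0" for x using anti[of x x] by simp
  have z: "linear (\<lambda>_::'v. 0::real)" by (simp add: linear_iff)
  have *: "A x e0 = 0" "A x e1 = 0" "A x e2 = 0" for x
    by (rule linear_eq_on_frame[OF l1 z]; use d zero anti[of e0 e1] anti[of e0 e2] anti[of e1 e2] in simp)+
  show ?thesis by (rule linear_eq_on_frame[OF l2 z]) (rule *)+
qed

locale curvature3 = curvature_tensor g r + orthogonal_frame3 g e0 e1 e2
  for g :: "'v::euclidean_space \<Rightarrow> 'v \<Rightarrow> real" and r e0 e1 e2
begin

text \<open>
By the symmetries a curvature tensor in dimension three has six independent components. The two that are
prescribed by \<open>\<kappa>\<close> and the three mixed ones that vanish leave only the sectional curvature \<open>\<mu>\<close> of the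
plane of \<open>e1\<close> and \<open>e2\<close>.
\<close>

lemma curvature_eq_model:
  assumes k01: "g (r e0 e1 e1) e0 = \<kappa> * g e0 e0 * g e1 e1"
    and k02: "g (r e0 e2 e2) e0 = \<kappa> * g e0 e0 * g e2 e2"
    and m: "g (r e0 e1 e2) e0 = 0" "g (r e1 e0 e2) e1 = 0" "g (r e2 e0 e1) e2 = 0"
  shows "\<exists>\<mu> \<nu>. \<kappa> = \<mu> + \<nu> * g e0 e0 \<and> (\<forall>x y z. r x y z = model_curvature e0 \<mu> \<nu> x y z)"
proof -
  define \<mu> where "\<mu> = g (r e1 e2 e2) e1 / (g e1 e1 * g e2 e2)"
  define \<nu> where "\<nu> = (\<kappa> - \<mu>) / g e0 e0"
  have \<kappa>: "\<kappa> = \<mu> + \<nu> * g e0 e0" using nonnull by (simp add: \<nu>_def)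
  have k12: "g (r e1 e2 e2) e1 = \<mu> * g e1 e1 * g e2 e2" using nonnull by (simp add: \<mu>_def)
  define \<Delta> where "\<Delta> x y z w = g (r x y z) w - g (model_curvature e0 \<mu> \<nu> x y z) w" for x y z w
  have anti: "g (r y x z) w = - g (r x y z) w" for x y z w
    by (simp add: r_antisym[of x y] g_simps)
  have \<Delta>_anti: "\<Delta> y x z w = - \<Delta> x y z w" "\<Delta> x y w z = - \<Delta> x y z w" for x y z w
    using anti[of y x z w] r_skew[of x y w z]
    by (simp_all add: \<Delta>_def model_curvature_def g_simps g_sym algebra_simps)
  have r_lin: "r (x + x') y z = r x y z + r x' y z" "r (c *\<^sub>R x) y z = c *\<^sub>R r x y z"
    "r x (y + y') z = r x y z + r x y' z" "r x (c *\<^sub>R y) z = c *\<^sub>R r x y z"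
    "r x y (z + z') = r x y z + r x y z'" "r x y (c *\<^sub>R z) = c *\<^sub>R r x y z" for x x' y y' z z' c
    using linear_r1[of y z] linear_r2[of x z] linear_r3[of x y] by (simp_all add: linear_iff)
  have \<Delta>_linear: "linear (\<lambda>x. \<Delta> x y z w)" "linear (\<lambda>y. \<Delta> x y z w)" "linear (\<lambda>z. \<Delta> x y z w)" "linear (\<Delta> x y z)"
    for x y z w
    by (simp_all add: linear_iff \<Delta>_def model_curvature_def r_lin g_simps algebra_simps)
  have v: "g (r e0 e1 e0) e1 = - (\<kappa> * g e0 e0 * g e1 e1)" "g (r e0 e2 e0) e2 = - (\<kappa> * g e0 e0 * g e2 e2)"
    "g (r e1 e2 e1) e2 = - (\<mu> * g e1 e1 * g e2 e2)"
    "g (r e0 e1 e0) e2 = 0" "g (r e0 e1 e1) e2 = 0" "g (r e0 e2 e1) e2 = 0"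
    using k01 k02 k12 m r_skew[of e0 e1 e0 e1] r_skew[of e0 e2 e0 e2] r_skew[of e1 e2 e1 e2]
      r_skew[of e0 e1 e0 e2] r_skew[of e0 e1 e1 e2] anti[of e1 e0 e2 e1] anti[of e2 e0 e1 e2] by simp_all
  have v': "g (r e0 e2 e0) e1 = 0" "g (r e1 e2 e0) e1 = 0" "g (r e1 e2 e0) e2 = 0"
    unfolding pair_symmetry[of e0 e2 e0 e1] pair_symmetry[of e1 e2 e0 e1] pair_symmetry[of e1 e2 e0 e2]
    by (rule v(4-6))+
  have z: "\<Delta> e0 e1 z w = 0" "\<Delta> e0 e2 z w = 0" "\<Delta> e1 e2 z w = 0" for z w
    by (rule alternating_eq_0[OF \<Delta>_linear(3,4) \<Delta>_anti(2)];
      simp add: \<Delta>_def v v' model_curvature_def g_simps frame_simps \<kappa> algebra_simps)+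
  have "\<Delta> x y z w = 0" for x y z w
    by (rule alternating_eq_0[OF \<Delta>_linear(1,2) \<Delta>_anti(1)]) (rule z)+
  then have "r x y z = model_curvature e0 \<mu> \<nu> x y z" for x y z
    by (intro g_eqI) (simp add: \<Delta>_def)
  with \<kappa> show ?thesis by blast
qed

text \<open>
In an orthogonal frame the off-diagonal components of the Ricci tensor are exactly the mixed components of
the curvature, and the diagonal ones are sums of two sectional curvatures each. The three equations for the
three sectional curvatures have a unique solution.
\<close>

lemma curvature_eq_model_if_ricci:
  assumes ricci: "\<And>y z. (\<Sum>b\<in>Basis. r b y z \<bullet> b) = a * g y z + b * g y e0 * g z e0"
  shows "\<exists>\<mu> \<nu>. (a + b * g e0 e0) / 2 = \<mu> + \<nu> * g e0 e0 \<and>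
    (\<forall>x y z. r x y z = model_curvature e0 \<mu> \<nu> x y z)"
proof -
  define K where "K x y = g (r x y y) x / (g x x * g y y)" for x y
  have S: "g (r e0 y z) e0 / g e0 e0 + g (r e1 y z) e1 / g e1 e1 + g (r e2 y z) e2 / g e2 e2 =
      a * g y z + b * g y e0 * g z e0" for y z
    using trace_frame[OF linear_r1[of y z]] ricci by simp
  \<comment> \<open>These kill the terms of the Ricci sums with a repeated frame vector.\<close>
  have d: "g (r x x z) w = 0" "g (r x y z) z = 0" for x y z w
    using r_skew[of x y z z] arg_cong[OF r_antisym[of x x z], of "\<lambda>v. g v w"] by (simp_all add: g_simps)
  have sym: "K y x = K x y" for x y
    using pair_symmetry[of x y y x] by (simp add: K_def mult.commute)
  have Kg: "g (r x y y) x = K x y * g x x * g y y" if "g x x \<noteq> 0" "g y y \<noteq> 0" for x y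
    using that by (simp add: K_def)
  have "g e0 e0 * (K e0 e1 + K e0 e2) = g e0 e0 * (a + b * g e0 e0)"
    "g e1 e1 * (K e0 e1 + K e1 e2) = g e1 e1 * a" "g e2 e2 * (K e0 e2 + K e1 e2) = g e2 e2 * a"
    using S[of e0 e0] S[of e1 e1] S[of e2 e2] nonnull
      Kg[of e1 e0] Kg[of e2 e0] Kg[of e0 e1] Kg[of e2 e1] Kg[of e0 e2] Kg[of e1 e2]
      sym[of e0 e1] sym[of e0 e2] sym[of e1 e2]
    by (simp_all add: d frame_simps field_simps)
  then have "K e0 e1 + K e0 e2 = a + b * g e0 e0" "K e0 e1 + K e1 e2 = a" "K e0 e2 + K e1 e2 = a"
    unfolding mult_cancel_left using nonnull by simp_all
  then have K: "K e0 e1 = (a + b * g e0 e0) / 2" "K e0 e2 = (a + b * g e0 e0) / 2" by simp_all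
  show ?thesis
  proof (rule curvature_eq_model[of "(a + b * g e0 e0) / 2"])
    show "g (r e0 e1 e1) e0 = (a + b * g e0 e0) / 2 * g e0 e0 * g e1 e1"
      "g (r e0 e2 e2) e0 = (a + b * g e0 e0) / 2 * g e0 e0 * g e2 e2"
      using Kg[of e0 e1] Kg[of e0 e2] nonnull K by simp_all
    show "g (r e0 e1 e2) e0 = 0" "g (r e1 e0 e2) e1 = 0" "g (r e2 e0 e1) e2 = 0"
      using S[of e1 e2] S[of e0 e2] S[of e0 e1] nonnull by (simp_all add: d frame_simps)
  qed
qed

text \<open>
By pair symmetry, the values \<open>r x y e0\<close> determine all components with \<open>e0\<close> among the arguments.
\<close>

lemma curvature_eq_model_if_nullity:
  assumes nullity: "\<And>x y. r x y e0 = \<kappa> *\<^sub>R (g y e0 *\<^sub>R x - g x e0 *\<^sub>R y)"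
  shows "\<exists>\<mu> \<nu>. \<kappa> = \<mu> + \<nu> * g e0 e0 \<and> (\<forall>x y z. r x y z = model_curvature e0 \<mu> \<nu> x y z)"
proof -
  have h: "g (r x y z) e0 = - \<kappa> * (g y e0 * g x z - g x e0 * g y z)" for x y z
    by (subst r_skew) (simp add: nullity g_simps)
  moreover have "g (r e1 e0 e2) e1 = 0" "g (r e2 e0 e1) e2 = 0"
    unfolding pair_symmetry[of e1 e0 e2 e1] pair_symmetry[of e2 e0 e1 e2]
    by (simp_all add: h frame_simps)
  ultimately show ?thesis by (intro curvature_eq_model) (simp_all add: frame_simps)
qed

end

context curvature_tensor
begin

definition curvature_action_at where
  "curvature_action_at F x y a b c = F x y (r a b c) - r (F x y a) b c - r a (F x y b) c - r a b (F x y c)"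

lemma curvature_action_at_if_ricci:
  assumes "DIM('v) = 3" "g \<xi> \<xi> \<noteq> 0"
    and "\<And>y z. (\<Sum>b\<in>Basis. r b y z \<bullet> b) = a * g y z + b * g y \<xi> * g z \<xi>"
  shows "curvature_action_at r x y u v w =
    ((a + b * g \<xi> \<xi>) / 2) *\<^sub>R curvature_action_at (\<lambda>x y z. g y z *\<^sub>R x - g x z *\<^sub>R y) x y u v w"
proof -
  obtain e1 e2 where "g \<xi> e1 = 0" "g \<xi> e2 = 0" "g e1 e2 = 0" "g e1 e1 \<noteq> 0" "g e2 e2 \<noteq> 0"
    using orthogonal_frame_exists[OF assms(1,2)] .
  then interpret curvature3 g r \<xi> e1 e2 by unfold_locales (use assms in auto)
  obtain \<mu> \<nu> where "(a + b * g \<xi> \<xi>) / 2 = \<mu> + \<nu> * g \<xi> \<xi>" "\<And>x y z. r x y z = model_curvature \<xi> \<mu> \<nu> x y z"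
    using curvature_eq_model_if_ricci[OF assms(3)] by blast
  then show ?thesis
    unfolding curvature_action_at_def using model_curvature_pseudo_symmetric[of \<xi> \<mu> \<nu> x y u v w] by simp
qed

lemma curvature_action_at_if_nullity:
  assumes "DIM('v) = 3" "g \<xi> \<xi> \<noteq> 0"
    and "\<And>x y. r x y \<xi> = \<kappa> *\<^sub>R (g y \<xi> *\<^sub>R x - g x \<xi> *\<^sub>R y)"
  shows "curvature_action_at r x y u v w =
    \<kappa> *\<^sub>R curvature_action_at (\<lambda>x y z. g y z *\<^sub>R x - g x z *\<^sub>R y) x y u v w"
proof -
  obtain e1 e2 where "g \<xi> e1 = 0" "g \<xi> e2 = 0" "g e1 e2 = 0" "g e1 e1 \<noteq> 0" "g e2 e2 \<noteq> 0"
    using orthogonal_frame_exists[OF assms(1,2)] .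
  then interpret curvature3 g r \<xi> e1 e2 by unfold_locales (use assms in auto)
  obtain \<mu> \<nu> where "\<kappa> = \<mu> + \<nu> * g \<xi> \<xi>" "\<And>x y z. r x y z = model_curvature \<xi> \<mu> \<nu> x y z"
    using curvature_eq_model_if_nullity[OF assms(3)] by blast
  then show ?thesis
    unfolding curvature_action_at_def using model_curvature_pseudo_symmetric[of \<xi> \<mu> \<nu> x y u v w] by simp
qed

end

section \<open>The curvature of the Levi-Civita connection\<close>

context manifold
begin

lemma tensor11_zero: "tensor11 M T \<Longrightarrow> T 0 = 0"
  using tensor11_add[of T 0 0] by simp

lemma tensor11_diff:
  assumes "tensor11 M T" "X \<in> \<X>" "Y \<in> \<X>"
  shows "T (X - Y) = T X - T Y"
proof -
  have "T X = T ((X - Y) + Y)" by simp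
  also have "\<dots> = T (X - Y) + T Y" by (rule tensor11_add[OF assms(1) diff_vf[OF assms(2,3)] assms(3)])
  finally show ?thesis by simp
qed

lemma one_form_diff:
  assumes "one_form M \<omega>" "X \<in> \<X>" "Y \<in> \<X>"
  shows "\<omega> (X - Y) = \<omega> X - \<omega> Y"
proof -
  have "\<omega> X = \<omega> ((X - Y) + Y)" by simp
  also have "\<dots> = \<omega> (X - Y) + \<omega> Y" by (rule one_form_add[OF assms(1) diff_vf[OF assms(2,3)] assms(3)])
  finally show ?thesis by simp
qed

lemma lie_bracket_antisym: "lie_bracket Y X = - lie_bracket X Y" for X Y :: "'a vfield"
  by (simp add: lie_bracket_def fun_eq_iff)

lemma lie_bracket_add_left:
  assumes Y: "Y \<in> \<X>" and X: "X \<in> \<X>" and X': "X' \<in> \<X>"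
  shows "lie_bracket (X + X') Y = lie_bracket X Y + lie_bracket X' Y"
proof (rule vf_eqI)
  fix h q assume h: "h \<in> \<F>"
  have "Y (X h + X' h) = Y (X h) + Y (X' h)" by (rule vf_add[OF Y vf_smooth[OF X h] vf_smooth[OF X' h]])
  then show "lie_bracket (X + X') Y h q = (lie_bracket X Y + lie_bracket X' Y) h q"
    by (simp add: lie_bracket_def)
qed (intro lie_bracket_vf add_vf assms)+

lemma lie_bracket_fscale_left:
  assumes Y: "Y \<in> \<X>" and X: "X \<in> \<X>" and f: "f \<in> \<F>"
  shows "lie_bracket (f \<odot> X) Y = f \<odot> lie_bracket X Y - Y f \<odot> X"
proof (rule vf_eqI)
  fix h q assume h: "h \<in> \<F>"
  have "Y (f * X h) = Y f * X h + f * Y (X h)" by (rule vf_mult[OF Y f vf_smooth[OF X h]])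
  then show "lie_bracket (f \<odot> X) Y h q = (f \<odot> lie_bracket X Y - Y f \<odot> X) h q"
    by (simp add: lie_bracket_def fscale_def algebra_simps)
qed (intro lie_bracket_vf diff_vf fscale_vf vf_smooth[OF Y] assms)+

lemma jacobi:
  assumes X: "X \<in> \<X>" and Y: "Y \<in> \<X>" and Z: "Z \<in> \<X>"
  shows "lie_bracket X (lie_bracket Y Z) + lie_bracket Y (lie_bracket Z X) + lie_bracket Z (lie_bracket X Y) = 0"
proof (rule vf_eqI)
  fix h q assume h: "h \<in> \<F>"
  have d: "A (B (C h) - C (B h)) = A (B (C h)) - A (C (B h))" if "A \<in> \<X>" "B \<in> \<X>" "C \<in> \<X>" for A B C
    by (rule vf_diff[OF that(1)]) (rule vf_smooth[OF that(2) vf_smooth[OF that(3) h]]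
        vf_smooth[OF that(3) vf_smooth[OF that(2) h]])+
  show "(lie_bracket X (lie_bracket Y Z) + lie_bracket Y (lie_bracket Z X) + lie_bracket Z (lie_bracket X Y)) h q =
      0 h q"
    by (simp add: lie_bracket_def d[OF X Y Z] d[OF Y Z X] d[OF Z X Y])
qed (intro lie_bracket_vf add_vf zero_vf assms)+

end

locale semi_riemannian_manifold = manifold M
  for M :: "('a::{t2_space, second_countable_topology}, 'e::euclidean_space) atlas" +
  fixes g :: "'a vfield \<Rightarrow> 'a vfield \<Rightarrow> 'a \<Rightarrow> real" and nabla :: "'a vfield \<Rightarrow> 'a vfield \<Rightarrow> 'a vfield"
  assumes metric: "semi_riemannian_metric M g" and levi_civita: "levi_civita M g nabla"
begin

abbreviation "R \<equiv> curvature nabla"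

lemma one_form_metric_right: "X \<in> \<X> \<Longrightarrow> one_form M (g X)"
  and one_form_metric_left: "Y \<in> \<X> \<Longrightarrow> one_form M (\<lambda>X. g X Y)"
  using metric unfolding semi_riemannian_metric_def tensor02_def by simp_all

lemma metric_sym: "X \<in> \<X> \<Longrightarrow> Y \<in> \<X> \<Longrightarrow> g X Y = g Y X"
  using metric unfolding semi_riemannian_metric_def by blast

lemma metric_nondegenerate: "X \<in> \<X> \<Longrightarrow> (\<And>Y. Y \<in> \<X> \<Longrightarrow> g X Y p = 0) \<Longrightarrow> X f p = 0"
  using metric unfolding semi_riemannian_metric_def by blast

lemma metric_smooth: "X \<in> \<X> \<Longrightarrow> Y \<in> \<X> \<Longrightarrow> g X Y \<in> \<F>"
  by (rule one_form_smooth[OF one_form_metric_right])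

lemma connection_tensor: "Y \<in> \<X> \<Longrightarrow> tensor11 M (\<lambda>X. nabla X Y)"
  and connection_add: "X \<in> \<X> \<Longrightarrow> Y \<in> \<X> \<Longrightarrow> Z \<in> \<X> \<Longrightarrow> nabla X (Y + Z) = nabla X Y + nabla X Z"
  and connection_leibniz: "X \<in> \<X> \<Longrightarrow> f \<in> \<F> \<Longrightarrow> Y \<in> \<X> \<Longrightarrow>
    nabla X (f \<odot> Y) = X f \<odot> Y + f \<odot> nabla X Y"
  and torsion_free: "X \<in> \<X> \<Longrightarrow> Y \<in> \<X> \<Longrightarrow> nabla X Y - nabla Y X = lie_bracket X Y"
  and metric_compatible: "X \<in> \<X> \<Longrightarrow> Y \<in> \<X> \<Longrightarrow> Z \<in> \<X> \<Longrightarrow>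
    X (g Y Z) = g (nabla X Y) Z + g Y (nabla X Z)"
  using levi_civita unfolding levi_civita_def affine_connection_def by (elim conjE; rule bspec | blast)+

lemma connection_vf: "X \<in> \<X> \<Longrightarrow> Y \<in> \<X> \<Longrightarrow> nabla X Y \<in> \<X>"
  by (rule tensor11_vf[OF connection_tensor])

lemma connection_diff:
  assumes "X \<in> \<X>" "Y \<in> \<X>" "Z \<in> \<X>"
  shows "nabla X (Y - Z) = nabla X Y - nabla X Z"
proof -
  have "nabla X Y = nabla X ((Y - Z) + Z)" by simp
  also have "\<dots> = nabla X (Y - Z) + nabla X Z"
    by (rule connection_add[OF assms(1) diff_vf[OF assms(2,3)] assms(3)])
  finally show ?thesis by simp
qed

lemma connection_zero: "X \<in> \<X> \<Longrightarrow> nabla X 0 = 0"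
  using connection_diff[of X 0 0] by simp

lemma connection_const: "X \<in> \<X> \<Longrightarrow> Y \<in> \<X> \<Longrightarrow> nabla X ((\<lambda>_. k) \<odot> Y) = (\<lambda>_. k) \<odot> nabla X Y"
  using connection_leibniz[OF _ smooth_const, of X Y k] by (simp add: vf_const fscale_def fun_eq_iff)

lemma curvature_vf: "X \<in> \<X> \<Longrightarrow> Y \<in> \<X> \<Longrightarrow> Z \<in> \<X> \<Longrightarrow> R X Y Z \<in> \<X>"
  unfolding curvature_def by (intro diff_vf connection_vf lie_bracket_vf)

lemma curvature_antisym:
  assumes "X \<in> \<X>" "Y \<in> \<X>" "Z \<in> \<X>"
  shows "R Y X Z = - R X Y Z"
proof -
  have "nabla (0 - lie_bracket X Y) Z = nabla 0 Z - nabla (lie_bracket X Y) Z"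
    by (rule tensor11_diff[OF connection_tensor[OF assms(3)] zero_vf lie_bracket_vf[OF assms(1,2)]])
  then have "nabla (lie_bracket Y X) Z = - nabla (lie_bracket X Y) Z"
    unfolding lie_bracket_antisym[of Y X] using tensor11_zero[OF connection_tensor[OF assms(3)]] by simp
  then show ?thesis by (simp add: curvature_def)
qed

text \<open>
Linearity over the smooth functions: the derivative of the coefficient that comes from \<open>nabla Y\<close> cancels
against the one that comes from the Lie bracket.
\<close>

lemma tensor11_curvature1:
  assumes Y: "Y \<in> \<X>" and Z: "Z \<in> \<X>"
  shows "tensor11 M (\<lambda>X. R X Y Z)"
proof (rule tensor11I)
  note t = connection_tensor[OF Z] connection_tensor[OF connection_vf[OF Y Z]]
  fix X assume X: "X \<in> \<X>"
  then show "R X Y Z \<in> \<X>" using Y Z by (rule curvature_vf)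
  note XZ = connection_vf[OF X Z]
  {
    fix X' assume X': "X' \<in> \<X>"
    show "R (X + X') Y Z = R X Y Z + R X' Y Z"
      unfolding curvature_def lie_bracket_add_left[OF Y X X'] tensor11_add[OF t(1) X X'] tensor11_add[OF t(2) X X']
        tensor11_add[OF t(1) lie_bracket_vf[OF X Y] lie_bracket_vf[OF X' Y]]
        connection_add[OF Y XZ connection_vf[OF X' Z]]
      by (simp add: algebra_simps)
  }
  fix f assume f: "f \<in> \<F>"
  note Yf = vf_smooth[OF Y f]
  have 1: "nabla (lie_bracket (f \<odot> X) Y) Z = f \<odot> nabla (lie_bracket X Y) Z - Y f \<odot> nabla X Z"
    by (simp only: lie_bracket_fscale_left[OF Y X f] tensor11_diff[OF t(1) fscale_vf[OF f lie_bracket_vf[OF X Y]] fscale_vf[OF Yf X]]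
        tensor11_fscale[OF t(1) f lie_bracket_vf[OF X Y]] tensor11_fscale[OF t(1) Yf X])
  have 2: "nabla Y (nabla (f \<odot> X) Z) = Y f \<odot> nabla X Z + f \<odot> nabla Y (nabla X Z)"
    by (simp only: tensor11_fscale[OF t(1) f X] connection_leibniz[OF Y f XZ])
  show "R (f \<odot> X) Y Z = f \<odot> R X Y Z"
    unfolding curvature_def 1 2 tensor11_fscale[OF t(2) f X]
    by (simp add: fscale_def fun_eq_iff algebra_simps)
qed

lemma tensor11_curvature2:
  assumes X: "X \<in> \<X>" and Z: "Z \<in> \<X>"
  shows "tensor11 M (\<lambda>Y. R X Y Z)"
proof (rule tensor11I)
  note t = tensor11_curvature1[OF X Z]
  fix Y assume Y: "Y \<in> \<X>"
  then show "R X Y Z \<in> \<X>" using X Z by (intro curvature_vf)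
  show "R X (Y + Y') Z = R X Y Z + R X Y' Z" if Y': "Y' \<in> \<X>" for Y'
    unfolding curvature_antisym[OF add_vf[OF Y Y'] X Z] curvature_antisym[OF Y X Z] curvature_antisym[OF Y' X Z]
      tensor11_add[OF t Y Y'] by simp
  show "R X (f \<odot> Y) Z = f \<odot> R X Y Z" if f: "f \<in> \<F>" for f
    unfolding curvature_antisym[OF fscale_vf[OF f Y] X Z] curvature_antisym[OF Y X Z] tensor11_fscale[OF t f Y]
    by (simp add: fscale_def fun_eq_iff)
qed

lemma tensor11_curvature3:
  assumes X: "X \<in> \<X>" and Y: "Y \<in> \<X>"
  shows "tensor11 M (R X Y)"
proof (rule tensor11I)
  note B = lie_bracket_vf[OF X Y]
  fix Z assume Z: "Z \<in> \<X>"
  note XZ = connection_vf[OF X Z] and YZ = connection_vf[OF Y Z]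
  show "R X Y Z \<in> \<X>" by (rule curvature_vf[OF X Y Z])
  {
    fix Z' assume Z': "Z' \<in> \<X>"
    show "R X Y (Z + Z') = R X Y Z + R X Y Z'"
      unfolding curvature_def connection_add[OF X Z Z'] connection_add[OF Y Z Z'] connection_add[OF B Z Z']
        connection_add[OF X YZ connection_vf[OF Y Z']] connection_add[OF Y XZ connection_vf[OF X Z']]
      by (simp add: algebra_simps)
  }
  fix f assume f: "f \<in> \<F>"
  have second: "nabla A (nabla C (f \<odot> Z)) =
      A (C f) \<odot> Z + C f \<odot> nabla A Z + (A f \<odot> nabla C Z + f \<odot> nabla A (nabla C Z))"
    if A: "A \<in> \<X>" and C: "C \<in> \<X>" for A C
    by (simp only: connection_leibniz[OF C f Z] connection_leibniz[OF A vf_smooth[OF C f] Z]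
        connection_leibniz[OF A f connection_vf[OF C Z]]
        connection_add[OF A fscale_vf[OF vf_smooth[OF C f] Z] fscale_vf[OF f connection_vf[OF C Z]]])
  show "R X Y (f \<odot> Z) = f \<odot> R X Y Z"
    unfolding curvature_def second[OF X Y] second[OF Y X] connection_leibniz[OF B f Z]
    by (simp add: lie_bracket_def fscale_def fun_eq_iff algebra_simps)
qed

text \<open>
The commutator of \<open>X\<close> and \<open>Y\<close> acts on the function \<open>g Z W\<close> as their Lie bracket. Metric compatibility,
applied twice, expands both sides; the terms with one derivative on each factor cancel.
\<close>

lemma curvature_skew:
  assumes X: "X \<in> \<X>" and Y: "Y \<in> \<X>" and Z: "Z \<in> \<X>" and W: "W \<in> \<X>"
  shows "g (R X Y Z) W = - g Z (R X Y W)"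
proof -
  note B = lie_bracket_vf[OF X Y]
  have second: "A (C (g Z W)) = g (nabla A (nabla C Z)) W + g (nabla C Z) (nabla A W) +
      (g (nabla A Z) (nabla C W) + g Z (nabla A (nabla C W)))" if A: "A \<in> \<X>" and C: "C \<in> \<X>" for A C
    by (simp only: metric_compatible[OF C Z W] metric_compatible[OF A connection_vf[OF C Z] W]
        metric_compatible[OF A Z connection_vf[OF C W]]
        vf_add[OF A metric_smooth[OF connection_vf[OF C Z] W] metric_smooth[OF Z connection_vf[OF C W]]])
  have "X (Y (g Z W)) - Y (X (g Z W)) = g (nabla (lie_bracket X Y) Z) W + g Z (nabla (lie_bracket X Y) W)"
    using metric_compatible[OF B Z W] by (simp add: lie_bracket_def)
  note e = this[unfolded second[OF X Y] second[OF Y X]]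
  note v = connection_vf[OF X connection_vf[OF Y Z]] connection_vf[OF Y connection_vf[OF X Z]] connection_vf[OF B Z]
    and w = connection_vf[OF X connection_vf[OF Y W]] connection_vf[OF Y connection_vf[OF X W]] connection_vf[OF B W]
  have l: "g (R X Y Z) W = g (nabla X (nabla Y Z)) W - g (nabla Y (nabla X Z)) W - g (nabla (lie_bracket X Y) Z) W"
    unfolding curvature_def
    by (simp only: one_form_diff[OF one_form_metric_left[OF W] diff_vf[OF v(1,2)] v(3)]
        one_form_diff[OF one_form_metric_left[OF W] v(1,2)])
  have r: "g Z (R X Y W) = g Z (nabla X (nabla Y W)) - g Z (nabla Y (nabla X W)) - g Z (nabla (lie_bracket X Y) W)"
    unfolding curvature_def
    by (simp only: one_form_diff[OF one_form_metric_right[OF Z] diff_vf[OF w(1,2)] w(3)]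
        one_form_diff[OF one_form_metric_right[OF Z] w(1,2)])
  show ?thesis
  proof
    show "g (R X Y Z) W q = (- g Z (R X Y W)) q" for q
      unfolding l r using fun_cong[OF e, of q] by simp
  qed
qed

text \<open>
Grouping the second derivatives by their outer vector field and removing the torsion reduces the cyclic sum
to the Jacobi identity.
\<close>

lemma first_bianchi:
  assumes X: "X \<in> \<X>" and Y: "Y \<in> \<X>" and Z: "Z \<in> \<X>"
  shows "R X Y Z + R Y Z X + R Z X Y = 0"
proof -
  have d: "nabla A (nabla B C) - nabla A (nabla C B) - nabla (lie_bracket B C) A = lie_bracket A (lie_bracket B C)"
    if A: "A \<in> \<X>" and B: "B \<in> \<X>" and C: "C \<in> \<X>" for A B C
    unfolding connection_diff[OF A connection_vf[OF B C] connection_vf[OF C B], symmetric] torsion_free[OF B C]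
    by (rule torsion_free[OF A lie_bracket_vf[OF B C]])
  have "R X Y Z + R Y Z X + R Z X Y =
     (nabla X (nabla Y Z) - nabla X (nabla Z Y) - nabla (lie_bracket Y Z) X) +
     (nabla Y (nabla Z X) - nabla Y (nabla X Z) - nabla (lie_bracket Z X) Y) +
     (nabla Z (nabla X Y) - nabla Z (nabla Y X) - nabla (lie_bracket X Y) Z)"
    by (simp add: curvature_def)
  also have "\<dots> = 0"
    unfolding d[OF X Y Z] d[OF Y Z X] d[OF Z X Y] by (rule jacobi[OF X Y Z])
  finally show ?thesis .
qed

end

text \<open>
At a point \<open>p\<close> the metric and the curvature become a bilinear form \<open>gp\<close> and a trilinear map \<open>rp\<close> on the
coordinate space, which form a curvature tensor in the algebraic sense.
\<close>

locale semi_riemannian_frame = semi_riemannian_manifold M g nabla + tangent_frame M p u E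
  for M :: "('a::{t2_space, second_countable_topology}, 'e::euclidean_space) atlas" and g nabla p u E
begin

definition gp :: "'e \<Rightarrow> 'e \<Rightarrow> real" where
  "gp v w = g (lift v) (lift w) p"

definition rp :: "'e \<Rightarrow> 'e \<Rightarrow> 'e \<Rightarrow> 'e" where
  "rp x y z = coord (R (lift x) (lift y) (lift z))"

lemma metric_at:
  assumes X: "X \<in> \<X>" and Y: "Y \<in> \<X>"
  shows "g X Y p = gp (coord X) (coord Y)"
  unfolding gp_def one_form_lift[OF one_form_metric_right[OF X] Y]
  by (rule one_form_lift[OF one_form_metric_left[OF lift_vf] X])

lemma curvature_at:
  assumes X: "X \<in> \<X>" and Y: "Y \<in> \<X>" and Z: "Z \<in> \<X>"
  shows "coord (R X Y Z) = rp (coord X) (coord Y) (coord Z)"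
  unfolding rp_def tensor11_lift[OF tensor11_curvature3[OF X Y] Z]
    tensor11_lift[OF tensor11_curvature2[OF X lift_vf] Y]
  by (rule tensor11_lift[OF tensor11_curvature1[OF lift_vf lift_vf] X])

lemma metric_curvature_at:
  assumes X: "X \<in> \<X>" and Y: "Y \<in> \<X>" and Z: "Z \<in> \<X>"
  shows "coord (metric_curvature g X Y Z) =
    gp (coord Y) (coord Z) *\<^sub>R coord X - gp (coord X) (coord Z) *\<^sub>R coord Y"
  by (simp add: metric_curvature_def coord_diff coord_fscale metric_at assms)

sublocale curvature_tensor gp rp
proof (intro curvature_tensor.intro nondegenerate_form.intro curvature_tensor_axioms.intro)
  show "linear (gp x)" for x
    unfolding gp_def[abs_def] by (rule one_form_linear[OF one_form_metric_right[OF lift_vf]])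
  show "gp x y = gp y x" for x y
    by (simp add: gp_def metric_sym[of "lift x" "lift y"])
  show "x = 0" if "\<And>y. gp x y = 0" for x
  proof -
    have "lift x f p = 0" for f
    proof (rule metric_nondegenerate[OF lift_vf])
      show "g (lift x) Y p = 0" if "Y \<in> \<X>" for Y
        unfolding metric_at[OF lift_vf that] coord_lift by fact
    qed
    then have "coord (lift x) = coord 0"
      unfolding coord_eq_iff[OF lift_vf zero_vf] by simp
    then show ?thesis by (simp add: coord_zero)
  qed
  show "linear (\<lambda>x. rp x y z)" for y z
    unfolding rp_def by (rule tensor11_linear[OF tensor11_curvature1]) simp_all
  show "linear (\<lambda>y. rp x y z)" for x z
    unfolding rp_def by (rule tensor11_linear[OF tensor11_curvature2]) simp_all
  show "linear (rp x y)" for x y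
    unfolding rp_def[abs_def] by (rule tensor11_linear[OF tensor11_curvature3]) simp_all
  show "rp y x z = - rp x y z" for x y z
    unfolding rp_def curvature_antisym[OF lift_vf lift_vf lift_vf, of y x] coord_minus ..
  show "gp (rp x y w) z = - gp (rp x y z) w" for x y z w
    using fun_cong[OF curvature_skew[OF lift_vf lift_vf lift_vf lift_vf, of x y w z], of p]
    by (simp add: metric_sym[of "lift w"] metric_at curvature_vf curvature_at)
  show "rp x y z + rp y z x + rp z x y = 0" for x y z
    unfolding rp_def coord_add[symmetric] first_bianchi[OF lift_vf lift_vf lift_vf] by (rule coord_zero)
qed

lemma ricci_at:
  assumes Y: "Y \<in> \<X>" and Z: "Z \<in> \<X>"
  shows "ricci M nabla Y Z p = (\<Sum>b\<in>Basis. rp b (coord Y) (coord Z) \<bullet> b)"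
  unfolding ricci_def trace_at_eq[OF tensor11_curvature1[OF Y Z]]
  by (simp add: curvature_at Y Z)

lemma curvature_action_curvature_at:
  assumes "X1 \<in> \<X>" "X2 \<in> \<X>" "X3 \<in> \<X>" "Y \<in> \<X>" "X \<in> \<X>"
  shows "coord (curvature_action R R X1 X2 X3 Y X) =
    curvature_action_at rp (coord X) (coord Y) (coord X1) (coord X2) (coord X3)"
  unfolding curvature_action_def curvature_action_at_def
  by (simp add: coord_diff curvature_at curvature_vf assms)

lemma metric_curvature_vf: "X \<in> \<X> \<Longrightarrow> Y \<in> \<X> \<Longrightarrow> Z \<in> \<X> \<Longrightarrow> metric_curvature g X Y Z \<in> \<X>"
  unfolding metric_curvature_def by (intro diff_vf fscale_vf metric_smooth)

lemma curvature_action_metric_curvature_at: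
  assumes "X1 \<in> \<X>" "X2 \<in> \<X>" "X3 \<in> \<X>" "Y \<in> \<X>" "X \<in> \<X>"
  shows "coord (curvature_action (metric_curvature g) R X1 X2 X3 Y X) =
    curvature_action_at (\<lambda>x y z. gp y z *\<^sub>R x - gp x z *\<^sub>R y)
      (coord X) (coord Y) (coord X1) (coord X2) (coord X3)"
  unfolding curvature_action_def curvature_action_at_def
  by (simp add: coord_diff curvature_at curvature_vf metric_curvature_at metric_curvature_vf assms)

lemma curvature_action_proportional:
  assumes "X1 \<in> \<X>" "X2 \<in> \<X>" "X3 \<in> \<X>" "Y \<in> \<X>" "X \<in> \<X>"
    and "\<And>x y a b c. curvature_action_at rp x y a b c =
      \<kappa> *\<^sub>R curvature_action_at (\<lambda>x y z. gp y z *\<^sub>R x - gp x z *\<^sub>R y) x y a b c"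
  shows "curvature_action R R X1 X2 X3 Y X f p =
    \<kappa> * curvature_action (metric_curvature g) R X1 X2 X3 Y X f p"
proof -
  let ?A = "curvature_action R R X1 X2 X3 Y X"
  let ?B = "curvature_action (metric_curvature g) R X1 X2 X3 Y X"
  have A: "?A \<in> \<X>"
    unfolding curvature_action_def by (intro diff_vf curvature_vf assms)
  have B: "?B \<in> \<X>"
    unfolding curvature_action_def by (intro diff_vf curvature_vf metric_curvature_vf assms)
  have "coord ?A = coord ((\<lambda>_. \<kappa>) \<odot> ?B)"
    unfolding coord_fscale curvature_action_metric_curvature_at[OF assms(1-5)]
      curvature_action_curvature_at[OF assms(1-5)] by (rule assms(6))
  then show ?thesis
    using coord_eq_iff[OF A fscale_vf[OF smooth_const B]] by simp
qed

end

context semi_riemannian_frame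
begin

lemma curvature_action_proportional_if_ricci:
  assumes dim: "DIM('e) = 3" and \<xi>: "\<xi> \<in> \<X>" "g \<xi> \<xi> p \<noteq> 0"
    and ricci: "\<And>Y Z. Y \<in> \<X> \<Longrightarrow> Z \<in> \<X> \<Longrightarrow> ricci M nabla Y Z p = a * g Y Z p + b * g Y \<xi> p * g Z \<xi> p"
    and "X1 \<in> \<X>" "X2 \<in> \<X>" "X3 \<in> \<X>" "Y \<in> \<X>" "X \<in> \<X>"
  shows "curvature_action R R X1 X2 X3 Y X f p =
    (a + b * g \<xi> \<xi> p) / 2 * curvature_action (metric_curvature g) R X1 X2 X3 Y X f p"
proof (rule curvature_action_proportional[OF assms(5-9)])
  have "(\<Sum>b\<in>Basis. rp b y z \<bullet> b) = a * gp y z + b * gp y (coord \<xi>) * gp z (coord \<xi>)" for y z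
    using ricci[OF lift_vf lift_vf, of y z]
    by (simp add: ricci_at[OF lift_vf lift_vf] metric_at[OF lift_vf lift_vf] metric_at[OF lift_vf \<xi>(1)])
  then show "curvature_action_at rp x y a' b' c =
    ((a + b * g \<xi> \<xi> p) / 2) *\<^sub>R
      curvature_action_at (\<lambda>x y z. gp y z *\<^sub>R x - gp x z *\<^sub>R y) x y a' b' c" for x y a' b' c
    unfolding metric_at[OF \<xi>(1) \<xi>(1)]
    using \<xi>(2) by (intro curvature_action_at_if_ricci[OF dim]) (simp_all add: metric_at[OF \<xi>(1) \<xi>(1)])
qed

lemma curvature_action_proportional_if_nullity:
  assumes dim: "DIM('e) = 3" and \<xi>: "\<xi> \<in> \<X>" "g \<xi> \<xi> p \<noteq> 0"
    and nullity: "\<And>X Y. X \<in> \<X> \<Longrightarrow> Y \<in> \<X> \<Longrightarrow> R X Y \<xi> = (\<lambda>_. \<kappa>) \<odot> metric_curvature g X Y \<xi>"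
    and "X1 \<in> \<X>" "X2 \<in> \<X>" "X3 \<in> \<X>" "Y \<in> \<X>" "X \<in> \<X>"
  shows "curvature_action R R X1 X2 X3 Y X f p =
    \<kappa> * curvature_action (metric_curvature g) R X1 X2 X3 Y X f p"
proof (rule curvature_action_proportional[OF assms(5-9)])
  have "rp x y (coord \<xi>) = \<kappa> *\<^sub>R (gp y (coord \<xi>) *\<^sub>R x - gp x (coord \<xi>) *\<^sub>R y)" for x y
    using curvature_at[OF lift_vf lift_vf \<xi>(1), of x y]
    by (simp add: nullity coord_fscale metric_curvature_at \<xi>(1))
  then show "curvature_action_at rp x y a' b' c =
    \<kappa> *\<^sub>R curvature_action_at (\<lambda>x y z. gp y z *\<^sub>R x - gp x z *\<^sub>R y) x y a' b' c" for x y a' b' c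
    using \<xi>(2) by (intro curvature_action_at_if_nullity[OF dim]) (simp_all add: metric_at[OF \<xi>(1) \<xi>(1)])
qed

end

context semi_riemannian_manifold
begin

lemma semi_riemannian_frame_exists: "\<exists>u E. semi_riemannian_frame M g nabla p u E"
proof -
  obtain u E where "tangent_frame M p u E" by (rule tangent_frame_exists)
  then show ?thesis
    using semi_riemannian_frame.intro semi_riemannian_manifold_axioms by blast
qed

lemma pseudo_symmetricI:
  assumes "L \<in> \<F>"
    and "\<And>p X1 X2 X3 Y X f. X1 \<in> \<X> \<Longrightarrow> X2 \<in> \<X> \<Longrightarrow> X3 \<in> \<X> \<Longrightarrow> Y \<in> \<X> \<Longrightarrow> X \<in> \<X> \<Longrightarrow>
      curvature_action R R X1 X2 X3 Y X f p = L p * curvature_action (metric_curvature g) R X1 X2 X3 Y X f p"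
  shows "pseudo_symmetric M g nabla"
  unfolding pseudo_symmetric_def Let_def
  by (rule bexI[OF _ assms(1)]) (intro ballI allI assms(2))

theorem pseudo_symmetric_if_ricci:
  assumes "DIM('e) = 3" "\<xi> \<in> \<X>" "\<And>p. g \<xi> \<xi> p \<noteq> 0" "a \<in> \<F>" "b \<in> \<F>"
    and "\<And>Y Z p. Y \<in> \<X> \<Longrightarrow> Z \<in> \<X> \<Longrightarrow> ricci M nabla Y Z p = a p * g Y Z p + b p * g Y \<xi> p * g Z \<xi> p"
  shows "pseudo_symmetric M g nabla"
proof (rule pseudo_symmetricI)
  show "(\<lambda>p. (1 / 2) * (a + b * g \<xi> \<xi>) p) \<in> \<F>"
    by (intro smooth_scale smooth_add smooth_mult metric_smooth assms)
  fix p X1 X2 X3 Y X f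
  assume X: "X1 \<in> \<X>" "X2 \<in> \<X>" "X3 \<in> \<X>" "Y \<in> \<X>" "X \<in> \<X>"
  obtain u E where "semi_riemannian_frame M g nabla p u E" using semi_riemannian_frame_exists by blast
  then interpret semi_riemannian_frame M g nabla p u E .
  have "ricci M nabla Y Z p = a p * g Y Z p + b p * g Y \<xi> p * g Z \<xi> p" if "Y \<in> \<X>" "Z \<in> \<X>" for Y Z
    by (rule assms(6)[OF that])
  from curvature_action_proportional_if_ricci[where a="a p" and b="b p" and f=f, OF assms(1-3) this X]
  show "curvature_action R R X1 X2 X3 Y X f p = (1 / 2) * (a + b * g \<xi> \<xi>) p *
      curvature_action (metric_curvature g) R X1 X2 X3 Y X f p" by simp
qed

text \<open>
The hypothesis says that \<open>\<xi>\<close> belongs to the \<open>\<kappa>\<close>-nullity distribution of the curvature.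
\<close>

theorem pseudo_symmetric_if_nullity:
  assumes "DIM('e) = 3" "\<xi> \<in> \<X>" "\<And>p. g \<xi> \<xi> p \<noteq> 0"
    and "\<And>X Y. X \<in> \<X> \<Longrightarrow> Y \<in> \<X> \<Longrightarrow> R X Y \<xi> = (\<lambda>_. \<kappa>) \<odot> metric_curvature g X Y \<xi>"
  shows "pseudo_symmetric M g nabla"
proof (rule pseudo_symmetricI[OF smooth_const[of \<kappa>]])
  fix p X1 X2 X3 Y X f
  assume X: "X1 \<in> \<X>" "X2 \<in> \<X>" "X3 \<in> \<X>" "Y \<in> \<X>" "X \<in> \<X>"
  obtain u E where "semi_riemannian_frame M g nabla p u E" using semi_riemannian_frame_exists by blast
  then interpret semi_riemannian_frame M g nabla p u E .
  show "curvature_action R R X1 X2 X3 Y X f p = \<kappa> * curvature_action (metric_curvature g) R X1 X2 X3 Y X f p"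
    by (rule curvature_action_proportional_if_nullity[OF assms X])
qed

end

section \<open>Paracontact metric manifolds\<close>

locale paracontact_manifold = semi_riemannian_manifold M g nabla
  for M :: "('a::{t2_space, second_countable_topology}, 'e::euclidean_space) atlas" and g nabla +
  fixes \<phi> :: "'a vfield \<Rightarrow> 'a vfield" and \<xi> :: "'a vfield"
    and \<eta> :: "'a vfield \<Rightarrow> 'a \<Rightarrow> real" and \<epsilon> :: real
  assumes eps_paracontact: "eps_almost_paracontact_metric M \<phi> \<xi> \<eta> g \<epsilon>"
begin

lemma paracontact: "almost_paracontact M \<phi> \<xi> \<eta>"
  using eps_paracontact unfolding eps_almost_paracontact_metric_def by (elim conjE)

lemma \<phi>_tensor: "tensor11 M \<phi>" and \<xi>_vf: "\<xi> \<in> \<X>" and \<eta>_form: "one_form M \<eta>"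
  and \<eta>_\<xi>: "\<eta> \<xi> = 1" and \<phi>_\<xi>: "\<phi> \<xi> = 0"
  using paracontact unfolding almost_paracontact_def by simp_all

lemma \<phi>_\<phi>: "X \<in> \<X> \<Longrightarrow> \<phi> (\<phi> X) = X - \<eta> X \<odot> \<xi>"
  and \<eta>_\<phi>: "X \<in> \<X> \<Longrightarrow> \<eta> (\<phi> X) = 0"
  using paracontact unfolding almost_paracontact_def by simp_all

lemmas \<phi>_vf = tensor11_vf[OF \<phi>_tensor]

lemma metric_\<phi>: "X \<in> \<X> \<Longrightarrow> Y \<in> \<X> \<Longrightarrow> g (\<phi> X) (\<phi> Y) p = g X Y p - \<epsilon> * \<eta> X p * \<eta> Y p"
  and \<epsilon>_cases: "\<epsilon> = 1 \<or> \<epsilon> = -1"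
  using eps_paracontact unfolding eps_almost_paracontact_metric_def by auto

lemma \<epsilon>_square: "\<epsilon> * \<epsilon> = 1"
  using \<epsilon>_cases by auto

lemma metric_\<xi>: "X \<in> \<X> \<Longrightarrow> g X \<xi> = (\<lambda>p. \<epsilon> * \<eta> X p)"
proof
  fix p assume X: "X \<in> \<X>"
  have "g (\<phi> X) 0 = 0" by (rule one_form_zero[OF one_form_metric_right[OF \<phi>_vf[OF X]]])
  then show "g X \<xi> p = \<epsilon> * \<eta> X p"
    using metric_\<phi>[OF X \<xi>_vf, of p] by (simp add: \<phi>_\<xi> \<eta>_\<xi>)
qed

lemma \<eta>_eq: "X \<in> \<X> \<Longrightarrow> \<eta> X p = \<epsilon> * g X \<xi> p"
  using \<epsilon>_square by (simp add: metric_\<xi> mult.assoc[symmetric])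

lemma metric_\<xi>_\<xi>: "g \<xi> \<xi> = (\<lambda>_. \<epsilon>)"
  by (simp add: metric_\<xi>[OF \<xi>_vf] \<eta>_\<xi>)

theorem pseudo_symmetric_if_eta_einstein:
  assumes "DIM('e) = 3" "eta_einstein M \<eta> g nabla"
  shows "pseudo_symmetric M g nabla"
proof -
  obtain a b where ab: "a \<in> \<F>" "b \<in> \<F>"
    and S: "\<forall>X\<in>\<X>. \<forall>Y\<in>\<X>. ricci M nabla X Y = a * g X Y + b * \<eta> X * \<eta> Y"
    using assms(2) unfolding eta_einstein_def by blast
  show ?thesis
  proof (rule pseudo_symmetric_if_ricci[OF assms(1) \<xi>_vf _ ab])
    show "g \<xi> \<xi> p \<noteq> 0" for p using \<epsilon>_cases by (auto simp: metric_\<xi>_\<xi>)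
    fix Y Z p assume Y: "Y \<in> \<X>" and Z: "Z \<in> \<X>"
    have "ricci M nabla Y Z = a * g Y Z + b * \<eta> Y * \<eta> Z" using S Y Z by blast
    then have "ricci M nabla Y Z p = a p * g Y Z p + b p * \<eta> Y p * \<eta> Z p" by simp
    also have "b p * \<eta> Y p * \<eta> Z p = (\<epsilon> * \<epsilon>) * (b p * g Y \<xi> p * g Z \<xi> p)"
      by (simp add: \<eta>_eq[OF Y] \<eta>_eq[OF Z])
    finally show "ricci M nabla Y Z p = a p * g Y Z p + b p * g Y \<xi> p * g Z \<xi> p"
      by (simp add: \<epsilon>_square)
  qed
qed

text \<open>
The defining equation with \<open>Y = \<xi>\<close> determines \<open>\<phi> (nabla X \<xi>)\<close>. Applying \<open>\<phi>\<close> once more recovers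
\<open>nabla X \<xi>\<close> itself up to its component along \<open>\<xi>\<close>, which vanishes because \<open>g \<xi> \<xi>\<close> is constant.
\<close>

lemma connection_\<xi>:
  assumes sasakian: "eps_para_sasakian M \<phi> \<xi> \<eta> g \<epsilon> nabla" and X: "X \<in> \<X>"
  shows "nabla X \<xi> = (\<lambda>_. \<epsilon>) \<odot> \<phi> X"
proof -
  note V = connection_vf[OF X \<xi>_vf]
  have "nabla X (\<phi> \<xi>) - \<phi> (nabla X \<xi>) =
      - (g (\<phi> X) (\<phi> \<xi>) \<odot> \<xi>) - (\<lambda>p. \<epsilon> * \<eta> \<xi> p) \<odot> \<phi> (\<phi> X)"
    using sasakian X \<xi>_vf unfolding eps_para_sasakian_def by blast
  moreover have "g (\<phi> X) 0 = 0" by (rule one_form_zero[OF one_form_metric_right[OF \<phi>_vf[OF X]]])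
  ultimately have "\<phi> (nabla X \<xi>) = (\<lambda>_. \<epsilon>) \<odot> \<phi> (\<phi> X)"
    by (simp add: \<phi>_\<xi> \<eta>_\<xi> connection_zero[OF X] fscale_def fun_eq_iff)
  then have "\<phi> (\<phi> (nabla X \<xi>)) = (\<lambda>_. \<epsilon>) \<odot> \<phi> (\<phi> (\<phi> X))"
    using tensor11_fscale[OF \<phi>_tensor smooth_const \<phi>_vf[OF \<phi>_vf[OF X]]] by simp
  moreover have "\<eta> (nabla X \<xi>) = 0"
  proof
    fix p
    have "X (g \<xi> \<xi>) = 0" unfolding metric_\<xi>_\<xi> by (rule vf_const[OF X])
    then have "g (nabla X \<xi>) \<xi> p + g \<xi> (nabla X \<xi>) p = 0"
      using fun_cong[OF metric_compatible[OF X \<xi>_vf \<xi>_vf], of p] by simp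
    then show "\<eta> (nabla X \<xi>) p = 0 p"
      by (simp add: \<eta>_eq[OF V] metric_sym[OF \<xi>_vf V])
  qed
  ultimately show ?thesis
    using \<phi>_\<phi>[OF V] \<phi>_\<phi>[OF \<phi>_vf[OF X]] \<eta>_\<phi>[OF X] by (simp add: fscale_def fun_eq_iff)
qed

text \<open>
Since \<open>nabla X \<xi> = \<epsilon> \<phi> X\<close>, the second derivatives of \<open>\<xi>\<close> are first derivatives of \<open>\<phi>\<close>. In their
skew part the symmetric term of the defining equation cancels.
\<close>

lemma curvature_\<xi>:
  assumes sasakian: "eps_para_sasakian M \<phi> \<xi> \<eta> g \<epsilon> nabla" and X: "X \<in> \<X>" and Y: "Y \<in> \<X>"
  shows "R X Y \<xi> = (\<lambda>_. - \<epsilon>) \<odot> metric_curvature g X Y \<xi>"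
proof -
  note XY = connection_vf[OF X Y] and YX = connection_vf[OF Y X] and B = lie_bracket_vf[OF X Y]
  note \<phi>X = \<phi>_vf[OF X] and \<phi>Y = \<phi>_vf[OF Y]
  have D: "nabla A (\<phi> C) = \<phi> (nabla A C) - g (\<phi> A) (\<phi> C) \<odot> \<xi> - (\<lambda>p. \<epsilon> * \<eta> C p) \<odot> (A - \<eta> A \<odot> \<xi>)"
    if "A \<in> \<X>" "C \<in> \<X>" for A C
  proof -
    have "nabla A (\<phi> C) - \<phi> (nabla A C) = - (g (\<phi> A) (\<phi> C) \<odot> \<xi>) - (\<lambda>p. \<epsilon> * \<eta> C p) \<odot> \<phi> (\<phi> A)"
      using sasakian that unfolding eps_para_sasakian_def by blast
    then show ?thesis unfolding \<phi>_\<phi>[OF that(1)] by (simp add: algebra_simps)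
  qed
  have 1: "nabla A (nabla C \<xi>) = (\<lambda>_. \<epsilon>) \<odot> nabla A (\<phi> C)" if A: "A \<in> \<X>" and C: "C \<in> \<X>" for A C
    unfolding connection_\<xi>[OF sasakian C] by (rule connection_const[OF A \<phi>_vf[OF C]])
  have 2: "\<phi> (lie_bracket X Y) = \<phi> (nabla X Y) - \<phi> (nabla Y X)"
    unfolding torsion_free[OF X Y, symmetric] by (rule tensor11_diff[OF \<phi>_tensor XY YX])
  have "R X Y \<xi> h q = ((\<lambda>_. - \<epsilon>) \<odot> metric_curvature g X Y \<xi>) h q" for h q
  proof -
    have "R X Y \<xi> h q = (\<epsilon> * \<epsilon>) * (\<eta> X q * Y h q - \<eta> Y q * X h q)"
      unfolding curvature_def 1[OF X Y] 1[OF Y X] connection_\<xi>[OF sasakian B] 2 D[OF X Y] D[OF Y X]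
        metric_sym[OF \<phi>Y \<phi>X] by (simp add: algebra_simps)
    also have "\<dots> = \<eta> X q * Y h q - \<eta> Y q * X h q" by (simp add: \<epsilon>_square)
    also have "\<dots> = ((\<lambda>_. - \<epsilon>) \<odot> metric_curvature g X Y \<xi>) h q"
      by (simp add: \<eta>_eq[OF X] \<eta>_eq[OF Y] metric_curvature_def algebra_simps)
    finally show ?thesis .
  qed
  then show ?thesis by (intro ext)
qed

theorem pseudo_symmetric_if_para_sasakian:
  assumes "DIM('e) = 3" "eps_para_sasakian M \<phi> \<xi> \<eta> g \<epsilon> nabla"
  shows "pseudo_symmetric M g nabla"
proof (rule pseudo_symmetric_if_nullity[OF assms(1) \<xi>_vf _ curvature_\<xi>[OF assms(2)]])
  show "g \<xi> \<xi> p \<noteq> 0" for p using \<epsilon>_cases by (auto simp: metric_\<xi>_\<xi>)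
qed

end

theorem theorem6p4:
  fixes M :: "('a::{t2_space, second_countable_topology}, 'e::euclidean_space) atlas"
    and \<phi> :: "'a vfield \<Rightarrow> 'a vfield" and \<xi> :: "'a vfield"
    and \<eta> :: "'a vfield \<Rightarrow> 'a \<Rightarrow> real" and g :: "'a vfield \<Rightarrow> 'a vfield \<Rightarrow> 'a \<Rightarrow> real"
    and \<epsilon> :: real and nabla :: "'a vfield \<Rightarrow> 'a vfield \<Rightarrow> 'a vfield"
  assumes "smooth_manifold M" and "DIM('e) = 3"
    and "eps_almost_paracontact_metric M \<phi> \<xi> \<eta> g \<epsilon>"
    and "levi_civita M g nabla"
  shows "(eta_einstein M \<eta> g nabla \<longrightarrow> pseudo_symmetric M g nabla) \<and>
         (eps_para_sasakian M \<phi> \<xi> \<eta> g \<epsilon> nabla \<longrightarrow> pseudo_symmetric M g nabla)"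
proof -
  have "semi_riemannian_metric M g"
    using assms(3) unfolding eps_almost_paracontact_metric_def by blast
  then interpret paracontact_manifold M g nabla \<phi> \<xi> \<eta> \<epsilon>
    using assms by unfold_locales
  show ?thesis
    using pseudo_symmetric_if_eta_einstein[OF assms(2)] pseudo_symmetric_if_para_sasakian[OF assms(2)]
    by blast
qed

end
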